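(* Let $\mathbb{K}$ be an algebraically closed field of characteristic zero, $d$ a positive integer, $e\in\mathbb{K}$ a primitive $d$-th root of unity, and let $\ell_0,\ell_1,\ell_2\ge 1$ be arbitrary integers with $n+1=\ell_0+\ell_1+\ell_2$. For integers $\alpha_1,\alpha_2$ let $M(\alpha_1,\alpha_2)\in\mathrm{GL}(n+1,\mathbb{K})$ be the diagonal matrix whose diagonal consists of $\ell_0$ entries equal to $1$, followed by $\ell_1$ entries $e^{\alpha_1}$ and $\ell_2$ entries $e^{\alpha_2}$. (a) If $d$ is even and $k$ is an integer with $\gcd(d,k)=1$, then for $G=\langle M(k,d-k)\rangle$ the algebra $\mathrm{A}(X_{n,d}^G)$ is G-quadratic. (b) If $\gcd(d,\alpha_1,\alpha_2)>1$, then for $G=\langle M(\alpha_1,\alpha_2)\rangle$ the algebra $\mathrm{A}(X_{n,d}^G)$ is G-quadratic.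
   Context: A diagonal matrix $\operatorname{diag}(g_0,\dots,g_n)$ acts on $\mathbb{K}[x_0,\dots,x_n]$ by $x_i\mapsto g_ix_i$. Let $\{m_1,\dots,m_\mu\}$ be the set of $G$-invariant monomials of degree $d$ in $\mathbb{K}[x_0,\dots,x_n]$; $X_{n,d}^G$ is the projective toric variety parameterized by this set, with homogeneous ideal $\mathrm{I}(X_{n,d}^G)=\ker(S=\mathbb{K}[w_1,\dots,w_\mu]\to\mathbb{K}[x_0,\dots,x_n],\ w_i\mapsto m_i)$ and coordinate ring $\mathrm{A}(X_{n,d}^G)=S/\mathrm{I}(X_{n,d}^G)\cong\mathbb{K}[m_1,\dots,m_\mu]$. The algebra is G-quadratic if its defining ideal has a Gröbner basis of polynomials of degree 2 with respect to some coordinate system of $S$ and some term order. *)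

theory Defs
  imports
    "HOL-Library.Poly_Mapping"
    "HOL-Algebra.Ideal"
    "HOL-Algebra.Generated_Groups"
    "HOL-Computational_Algebra.Polynomial"
    "Jordan_Normal_Form.Matrix"
begin

section \<open>Multivariate polynomials\<close>

text \<open>
  A monomial in variables of type \<open>'v\<close> is its exponent vector, so that addition of exponent
  vectors is multiplication of monomials; a polynomial maps each monomial to its coefficient.
\<close>

type_synonym 'v monom = "'v \<Rightarrow>\<^sub>0 nat"
type_synonym ('v, 'a) mpoly = "'v monom \<Rightarrow>\<^sub>0 'a"

definition mdeg :: "'v monom \<Rightarrow> nat" where
  "mdeg m = (\<Sum>v\<in>Poly_Mapping.keys m. Poly_Mapping.lookup m v)"

definition monoms :: "'v set \<Rightarrow> 'v monom set" where
  "monoms V = {m. Poly_Mapping.keys m \<subseteq> V}"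

definition mconst :: "'a \<Rightarrow> ('v, 'a::comm_ring_1) mpoly" where
  "mconst c = Poly_Mapping.single 0 c"

definition of_monom :: "'v monom \<Rightarrow> ('v, 'a::comm_ring_1) mpoly" where
  "of_monom m = Poly_Mapping.single m 1"

definition mvar :: "'v \<Rightarrow> ('v, 'a::comm_ring_1) mpoly" where
  "mvar v = of_monom (Poly_Mapping.single v 1)"

text \<open>The polynomial ring \<open>K[V]\<close>, for a set \<open>V\<close> of variables.\<close>

definition mpoly_ring :: "'v set \<Rightarrow> ('v, 'a::comm_ring_1) mpoly ring" where
  "mpoly_ring V =
     \<lparr>carrier = {p. Poly_Mapping.keys p \<subseteq> monoms V},
      monoid.mult = (*), one = 1, zero = 0, add = (+)\<rparr>"

text \<open>The \<open>K\<close>-algebra homomorphism sending each variable \<open>v\<close> to \<open>f v\<close>.\<close>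

definition mpoly_subst ::
  "('v \<Rightarrow> ('u, 'a) mpoly) \<Rightarrow> ('v, 'a::comm_ring_1) mpoly \<Rightarrow> ('u, 'a) mpoly" where
  "mpoly_subst f p =
     (\<Sum>m\<in>Poly_Mapping.keys p. mconst (Poly_Mapping.lookup p m) *
        (\<Prod>v\<in>Poly_Mapping.keys m. f v ^ Poly_Mapping.lookup m v))"

text \<open>The zero polynomial is homogeneous of every degree.\<close>

definition homogeneous :: "nat \<Rightarrow> ('v, 'a::comm_ring_1) mpoly \<Rightarrow> bool" where
  "homogeneous k p \<longleftrightarrow> (\<forall>m\<in>Poly_Mapping.keys p. mdeg m = k)"


section \<open>Groebner bases and G-quadratic algebras\<close>

text \<open>
  A term order on the monomials in \<open>V\<close>: a total order, compatible with multiplication, with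
  the monomial 1 (the exponent vector \<open>0\<close>) as least element.
\<close>

definition term_order :: "'v set \<Rightarrow> ('v monom \<Rightarrow> 'v monom \<Rightarrow> bool) \<Rightarrow> bool" where
  "term_order V tle \<longleftrightarrow>
     (\<forall>s\<in>monoms V. tle s s) \<and>
     (\<forall>s\<in>monoms V. \<forall>t\<in>monoms V. tle s t \<and> tle t s \<longrightarrow> s = t) \<and>
     (\<forall>s\<in>monoms V. \<forall>t\<in>monoms V. \<forall>u\<in>monoms V. tle s t \<and> tle t u \<longrightarrow> tle s u) \<and>
     (\<forall>s\<in>monoms V. \<forall>t\<in>monoms V. tle s t \<or> tle t s) \<and>
     (\<forall>s\<in>monoms V. tle 0 s) \<and>
     (\<forall>s\<in>monoms V. \<forall>t\<in>monoms V. \<forall>u\<in>monoms V. tle s t \<longrightarrow> tle (s + u) (t + u))"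

text \<open>Only meaningful for \<open>p \<noteq> 0\<close>.\<close>

definition lead_monom ::
  "('v monom \<Rightarrow> 'v monom \<Rightarrow> bool) \<Rightarrow> ('v, 'a::comm_ring_1) mpoly \<Rightarrow> 'v monom" where
  "lead_monom tle p =
     (THE m. m \<in> Poly_Mapping.keys p \<and> (\<forall>m'\<in>Poly_Mapping.keys p. tle m' m))"

definition initial_ideal ::
  "'v set \<Rightarrow> ('v monom \<Rightarrow> 'v monom \<Rightarrow> bool) \<Rightarrow> ('v, 'a::comm_ring_1) mpoly set \<Rightarrow>
     ('v, 'a) mpoly set" where
  "initial_ideal V tle P =
     Idl\<^bsub>mpoly_ring V\<^esub> {of_monom (lead_monom tle p) | p. p \<in> P \<and> p \<noteq> 0}"

definition groebner_basis ::
  "'v set \<Rightarrow> ('v monom \<Rightarrow> 'v monom \<Rightarrow> bool) \<Rightarrow> ('v, 'a::comm_ring_1) mpoly set \<Rightarrow>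
     ('v, 'a) mpoly set \<Rightarrow> bool" where
  "groebner_basis V tle I B \<longleftrightarrow>
     finite B \<and> B \<subseteq> I - {0} \<and> initial_ideal V tle B = initial_ideal V tle I"

text \<open>
  A coordinate system of the standard graded ring \<open>K[V]\<close>: linear forms \<open>y v\<close> (\<open>v \<in> V\<close>) such that
  the \<open>K\<close>-algebra endomorphism \<open>v \<mapsto> y v\<close> is an automorphism.
\<close>

definition coordinate_system :: "'v set \<Rightarrow> ('v \<Rightarrow> ('v, 'a::comm_ring_1) mpoly) \<Rightarrow> bool" where
  "coordinate_system V y \<longleftrightarrow>
     (\<forall>v\<in>V. y v \<in> carrier (mpoly_ring V) \<and> homogeneous 1 (y v)) \<and>
     bij_betw (mpoly_subst y) (carrier (mpoly_ring V)) (carrier (mpoly_ring V))"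

text \<open>
  The ideal \<open>I\<close> written in the coordinates \<open>y\<close>: a polynomial \<open>F\<close> in \<open>K[V]\<close> stands for the
  element \<open>F(y)\<close>.
\<close>

definition in_coordinates ::
  "'v set \<Rightarrow> ('v \<Rightarrow> ('v, 'a::comm_ring_1) mpoly) \<Rightarrow> ('v, 'a) mpoly set \<Rightarrow> ('v, 'a) mpoly set" where
  "in_coordinates V y I = {F \<in> carrier (mpoly_ring V). mpoly_subst y F \<in> I}"

text \<open>
  The algebra \<open>K[V] / I\<close>, presented by its defining (homogeneous) ideal \<open>I\<close>, is G-quadratic. The
  elements of a Groebner basis are non-zero by definition, so \<open>homogeneous 2\<close> makes each of them a
  form of degree exactly 2. If \<open>I\<close> contains no linear form, as for a toric ideal, every polynomial
  of degree 2 in it is such a form.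
\<close>

definition G_quadratic :: "'v set \<Rightarrow> ('v, 'a::comm_ring_1) mpoly set \<Rightarrow> bool" where
  "G_quadratic V I \<longleftrightarrow>
     (\<exists>y tle B. coordinate_system V y \<and> term_order V tle \<and>
        groebner_basis V tle (in_coordinates V y I) B \<and> (\<forall>b\<in>B. homogeneous 2 b))"


section \<open>The toric variety of a group of diagonal matrices\<close>

definition GL :: "nat \<Rightarrow> 'a::field mat monoid" where
  "GL N = units_of (ring_mat TYPE('a) N ())"

text \<open>\<open>x\<^sub>i \<mapsto> g\<^sub>i x\<^sub>i\<close>; meant for diagonal matrices \<open>g\<close> only.\<close>

definition diag_act :: "'a::field mat \<Rightarrow> (nat, 'a) mpoly \<Rightarrow> (nat, 'a) mpoly" where
  "diag_act g = mpoly_subst (\<lambda>i. mconst (g $$ (i, i)) * mvar i)"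

definition invariant_monoms :: "nat \<Rightarrow> nat \<Rightarrow> 'a::field mat set \<Rightarrow> nat monom set" where
  "invariant_monoms n d G =
     {m \<in> monoms {0..n}. mdeg m = d \<and> (\<forall>g\<in>G. diag_act g (of_monom m) = of_monom m)}"

text \<open>
  The homogeneous ideal of \<open>X\<^sub>n\<^sub>,\<^sub>d\<^sup>G\<close>. The variables \<open>w\<^sub>i\<close> of the ring \<open>S\<close> are indexed by the
  monomials \<open>m\<^sub>i\<close> themselves, so \<open>S\<close> is \<open>mpoly_ring (invariant_monoms n d G)\<close>, and the coordinate
  ring of \<open>X\<^sub>n\<^sub>,\<^sub>d\<^sup>G\<close> is its quotient by this ideal.
\<close>

definition toric_ideal :: "nat \<Rightarrow> nat \<Rightarrow> 'a::field mat set \<Rightarrow> (nat monom, 'a) mpoly set" where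
  "toric_ideal n d G =
     a_kernel (mpoly_ring (invariant_monoms n d G)) (mpoly_ring {0..n}) (mpoly_subst of_monom)"

definition coordinate_ring_G_quadratic :: "nat \<Rightarrow> nat \<Rightarrow> 'a::field mat set \<Rightarrow> bool" where
  "coordinate_ring_G_quadratic n d G \<longleftrightarrow>
     G_quadratic (invariant_monoms n d G) (toric_ideal n d G)"

definition primitive_root_of_unity :: "nat \<Rightarrow> 'a::field \<Rightarrow> bool" where
  "primitive_root_of_unity d e \<longleftrightarrow> e ^ d = 1 \<and> (\<forall>j. 0 < j \<and> j < d \<longrightarrow> e ^ j \<noteq> 1)"

definition diag_M :: "'a::field \<Rightarrow> nat \<Rightarrow> nat \<Rightarrow> nat \<Rightarrow> int \<Rightarrow> int \<Rightarrow> 'a mat" where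
  "diag_M e l0 l1 l2 \<alpha>1 \<alpha>2 =
     mat_diag (l0 + l1 + l2)
       (\<lambda>i. if i < l0 then 1 else if i < l0 + l1 then e powi \<alpha>1 else e powi \<alpha>2)"

end

theory Submission
  imports Defs "HOL-Library.Product_Lexorder"
begin

text \<open>
  Rank the monomials that generate the toric algebra and take the degree reverse lexicographic order
  in which higher ranked variables are smaller. The toric ideal has a quadratic Groebner basis as soon
  as the following exchange property holds: whenever \<open>w\<close> divides a product of generators, all of lower
  rank than \<open>w\<close>, two of these factors \<open>x\<close>, \<open>y\<close> can be replaced by generators with the same product,
  one of which outranks both.

  Only the degrees of a monomial in the three blocks of equal eigenvalue matter for invariance. The
  ranking puts a class of special generators above all others and is lexicographic otherwise. In (b),
  with \<open>g = gcd(d, \<alpha>\<^sub>1, \<alpha>\<^sub>2)\<close> and \<open>d = g c\<close>, a generator is special if all its block degrees are multiples of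
  \<open>c\<close>; as \<open>g \<ge> 2\<close>, a special one can be split off from the product of any two generators. In (a) the
  special generators are those with equal degrees in the last two blocks, all others having degree \<open>d\<close>
  in one of these. Special factors are improved lexicographically by exchanging letters with another
  factor, within a block or between blocks.
\<close>

section \<open>Monomials\<close>

lemma mdeg_eq_sum:
  assumes "finite A" "Poly_Mapping.keys m \<subseteq> A"
  shows "mdeg m = (\<Sum>v\<in>A. Poly_Mapping.lookup m v)"
  unfolding mdeg_def using assms
  by (intro sum.mono_neutral_left) (auto simp: in_keys_iff)

lemma keys_add_nat: "Poly_Mapping.keys (s + t) = Poly_Mapping.keys s \<union> Poly_Mapping.keys t" for s t :: "'v monom"
  by (auto simp: in_keys_iff lookup_add)

lemma mdeg_add: "mdeg (s + t) = mdeg s + mdeg t"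
  by (simp add: mdeg_eq_sum[of "Poly_Mapping.keys s \<union> Poly_Mapping.keys t"] keys_add_nat lookup_add sum.distrib)

lemma mdeg_0 [simp]: "mdeg 0 = 0"
  by (simp add: mdeg_def)

lemma mdeg_single [simp]: "mdeg (Poly_Mapping.single v k) = k"
  by (simp add: mdeg_eq_sum[of "{v}"])

lemma mdeg_eq_0_iff: "mdeg m = 0 \<longleftrightarrow> m = 0"
  by (auto simp: mdeg_def in_keys_iff intro: poly_mapping_eqI)

lemma mdeg_sum: "mdeg (\<Sum>i\<in>A. f i) = (\<Sum>i\<in>A. mdeg (f i))"
  by (induction A rule: infinite_finite_induct) (auto simp: mdeg_add)

lemma monoms_0 [simp]: "0 \<in> monoms V"
  by (simp add: monoms_def)

lemma monoms_add_iff [simp]: "s + t \<in> monoms V \<longleftrightarrow> s \<in> monoms V \<and> t \<in> monoms V"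
  by (auto simp: monoms_def keys_add_nat)

lemma monoms_single [simp]: "v \<in> V \<Longrightarrow> Poly_Mapping.single v k \<in> monoms V"
  by (auto simp: monoms_def)

lemma monom_le_decomp:
  fixes s t :: "'v monom"
  assumes "\<And>v. Poly_Mapping.lookup s v \<le> Poly_Mapping.lookup t v"
  obtains r where "t = s + r"
proof
  show "t = s + (t - s)"
    by (rule poly_mapping_eqI) (simp add: lookup_add lookup_minus assms)
qed

lemma in_keys_decomp:
  fixes m :: "'v monom"
  assumes "v \<in> Poly_Mapping.keys m"
  obtains m0 where "m = Poly_Mapping.single v 1 + m0"
proof (rule monom_le_decomp)
  show "Poly_Mapping.lookup (Poly_Mapping.single v 1) u \<le> Poly_Mapping.lookup m u" for u
    using assms by (cases "u = v") (auto simp: lookup_single in_keys_iff)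
qed

lemma finite_monoms_mdeg:
  assumes "finite V"
  shows "finite {m \<in> monoms V. mdeg m = k}"
proof (rule finite_imageD)
  show "inj_on Poly_Mapping.lookup {m \<in> monoms V. mdeg m = k}"
    by (auto simp: inj_on_def)
  show "finite (Poly_Mapping.lookup ` {m \<in> monoms V. mdeg m = k})"
  proof (rule finite_subset)
    show "Poly_Mapping.lookup ` {m \<in> monoms V. mdeg m = k} \<subseteq> {f. \<forall>v. (v \<in> V \<longrightarrow> f v \<in> {..k}) \<and> (v \<notin> V \<longrightarrow> f v = 0)}"
    proof clarify
      fix m :: "'a monom" and v
      assume m: "m \<in> monoms V" and k: "k = mdeg m"
      have "v \<notin> V \<Longrightarrow> Poly_Mapping.lookup m v = 0"
        using m by (auto simp: monoms_def in_keys_iff)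
      moreover have "v \<in> V \<Longrightarrow> Poly_Mapping.lookup m v \<le> mdeg m"
        using m assms by (auto simp: mdeg_eq_sum[of V] monoms_def intro: member_le_sum)
      ultimately show "(v \<in> V \<longrightarrow> Poly_Mapping.lookup m v \<in> {..mdeg m}) \<and> (v \<notin> V \<longrightarrow> Poly_Mapping.lookup m v = 0)"
        by simp
    qed
    show "finite {f. \<forall>v. (v \<in> V \<longrightarrow> f v \<in> {..k}) \<and> (v \<notin> V \<longrightarrow> f v = (0::nat))}"
      using finite_set_of_finite_funs[OF assms, of "{..k}" 0] by simp
  qed
qed

text \<open>The inner sum is a power of \<open>f v\<close>, written additively. For variables that
  are themselves monomials and \<open>f\<close> the identity, this is the parametrization of the
  toric variety, restricted to monomials.\<close>

definition monom_subst :: "('v \<Rightarrow> 'u monom) \<Rightarrow> 'v monom \<Rightarrow> 'u monom" where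
  "monom_subst f m = (\<Sum>v\<in>Poly_Mapping.keys m. \<Sum>j<Poly_Mapping.lookup m v. f v)"

lemma lookup_monom_subst:
  "Poly_Mapping.lookup (monom_subst f m) i = (\<Sum>v\<in>Poly_Mapping.keys m. Poly_Mapping.lookup m v * Poly_Mapping.lookup (f v) i)"
  by (simp add: monom_subst_def lookup_sum)

lemma monom_subst_add: "monom_subst f (s + t) = monom_subst f s + monom_subst f t"
proof (rule poly_mapping_eqI)
  have *: "Poly_Mapping.lookup (monom_subst f m) i = (\<Sum>v\<in>Poly_Mapping.keys s \<union> Poly_Mapping.keys t. Poly_Mapping.lookup m v * Poly_Mapping.lookup (f v) i)"
    if "Poly_Mapping.keys m \<subseteq> Poly_Mapping.keys s \<union> Poly_Mapping.keys t" for m i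
    unfolding lookup_monom_subst using that
    by (intro sum.mono_neutral_left) (auto simp: in_keys_iff)
  show "Poly_Mapping.lookup (monom_subst f (s + t)) i = Poly_Mapping.lookup (monom_subst f s + monom_subst f t) i" for i
    by (simp add: * keys_add_nat lookup_add sum.distrib algebra_simps)
qed

text \<open>\<open>Suc 0\<close> is the form in which simp leaves \<open>1\<close>.\<close>

lemma monom_subst_single [simp]: "monom_subst f (Poly_Mapping.single v (Suc 0)) = f v"
  by (simp add: monom_subst_def)

lemma monom_subst_var [simp]: "monom_subst (\<lambda>v. Poly_Mapping.single v (Suc 0)) m = m"
  by (rule poly_mapping_eqI)
     (auto simp: lookup_monom_subst lookup_single when_def in_keys_iff if_distrib sum.delta cong: if_cong)

text \<open>Generators of one common degree \<open>d > 0\<close> make the parametrization graded up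
  to the factor \<open>d\<close>, so monomials of one fibre have equal degree.\<close>

lemma mdeg_monom_subst:
  assumes "\<And>v. v \<in> Poly_Mapping.keys m \<Longrightarrow> mdeg (f v) = d"
  shows "mdeg (monom_subst f m) = d * mdeg m"
  by (simp add: monom_subst_def mdeg_sum assms) (simp add: mdeg_def sum_distrib_left mult.commute)

section \<open>Polynomials\<close>

lemma of_monom_0 [simp]: "of_monom 0 = 1"
  by (simp add: of_monom_def)

lemma of_monom_add: "of_monom (s + t) = of_monom s * of_monom t"
  by (simp add: of_monom_def mult_single)

lemma of_monom_sum: "of_monom (\<Sum>i\<in>A. f i) = (\<Prod>i\<in>A. of_monom (f i))"
  by (induction A rule: infinite_finite_induct) (auto simp: of_monom_add)

lemma mconst_times_of_monom: "mconst c * of_monom m = Poly_Mapping.single m c"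
  by (simp add: mconst_def of_monom_def mult_single)

lemma mconst_1 [simp]: "mconst 1 = 1"
  by (simp add: mconst_def)

lemma mconst_mult: "mconst (a * b) = mconst a * mconst b"
  by (simp add: mconst_def mult_single)

lemma mconst_power: "mconst (a ^ k) = mconst a ^ k"
  by (induction k) (auto simp: mconst_mult)

lemma mconst_prod: "mconst (\<Prod>i\<in>A. f i) = (\<Prod>i\<in>A. mconst (f i))"
  by (induction A rule: infinite_finite_induct) (auto simp: mconst_mult)

lemma prod_of_monom_power:
  "(\<Prod>v\<in>Poly_Mapping.keys m. of_monom (f v) ^ Poly_Mapping.lookup m v) = of_monom (monom_subst f m)"
  by (simp add: monom_subst_def of_monom_sum)

lemma poly_mapping_eq_sum_single: "p = (\<Sum>m\<in>Poly_Mapping.keys p. Poly_Mapping.single m (Poly_Mapping.lookup p m))"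
  by (rule poly_mapping_eqI)
     (auto simp: lookup_sum lookup_single when_def in_keys_iff sum.delta)

lemma mpoly_subst_of_monom:
  "mpoly_subst (\<lambda>v. of_monom (f v)) p = (\<Sum>m\<in>Poly_Mapping.keys p. Poly_Mapping.single (monom_subst f m) (Poly_Mapping.lookup p m))"
  by (simp add: mpoly_subst_def prod_of_monom_power mconst_times_of_monom)

lemma mpoly_subst_mvar: "mpoly_subst mvar p = p"
proof -
  have "mpoly_subst mvar p = mpoly_subst (\<lambda>v. of_monom (Poly_Mapping.single v 1)) p"
    by (simp add: mvar_def [abs_def])
  also have "\<dots> = p"
    by (simp add: mpoly_subst_of_monom poly_mapping_eq_sum_single[symmetric])
  finally show ?thesis .
qed

lemma mpoly_subst_on_monom:
  "mpoly_subst f (of_monom m) = (\<Prod>v\<in>Poly_Mapping.keys m. f v ^ Poly_Mapping.lookup m v)"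
  by (simp add: mpoly_subst_def of_monom_def)

text \<open>The quadratic basis will be found in the given variables, for which the substitution is
  the identity.\<close>

lemma coordinate_system_mvar: "coordinate_system V mvar"
  unfolding coordinate_system_def
proof (intro conjI ballI)
  have "mpoly_subst mvar = (id :: ('a, 'b) mpoly \<Rightarrow> _)"
    by (auto simp: mpoly_subst_mvar)
  then show "bij_betw (mpoly_subst mvar) (carrier (mpoly_ring V)) (carrier (mpoly_ring V :: ('a, 'b) mpoly ring))"
    by simp
qed (auto simp: mpoly_ring_def mvar_def of_monom_def homogeneous_def)

lemma in_coordinates_mvar:
  assumes "I \<subseteq> carrier (mpoly_ring V)"
  shows "in_coordinates V mvar I = I"
  using assms by (auto simp: in_coordinates_def mpoly_subst_mvar)

section \<open>Leading monomials\<close>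

lemma term_orderD:
  assumes "term_order V tle"
  shows "\<And>s. s \<in> monoms V \<Longrightarrow> tle s s"
    and "\<And>s t. s \<in> monoms V \<Longrightarrow> t \<in> monoms V \<Longrightarrow> tle s t \<Longrightarrow> tle t s \<Longrightarrow> s = t"
    and "\<And>s t u. s \<in> monoms V \<Longrightarrow> t \<in> monoms V \<Longrightarrow> u \<in> monoms V \<Longrightarrow>
           tle s t \<Longrightarrow> tle t u \<Longrightarrow> tle s u"
    and "\<And>s t. s \<in> monoms V \<Longrightarrow> t \<in> monoms V \<Longrightarrow> tle s t \<or> tle t s"
  using assms unfolding term_order_def by blast+

lemma finite_max_monom:
  assumes "term_order V tle" "finite A" "A \<noteq> {}" "A \<subseteq> monoms V"
  shows "\<exists>m\<in>A. \<forall>m'\<in>A. tle m' m"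
  using assms(2-4)
proof (induction A rule: finite_ne_induct)
  case (singleton x)
  then show ?case using term_orderD(1)[OF assms(1)] by auto
next
  case (insert x A)
  then obtain m where m: "m \<in> A" "\<forall>m'\<in>A. tle m' m" by auto
  have V: "x \<in> monoms V" "m \<in> monoms V" using insert m by auto
  show ?case
  proof (cases "tle x m")
    case True
    then show ?thesis using m by auto
  next
    case False
    then have "tle m x" using term_orderD(4)[OF assms(1) V] by blast
    then have "\<forall>m'\<in>A. tle m' x"
      using term_orderD(3)[OF assms(1)] m insert.prems V by blast
    then show ?thesis using term_orderD(1)[OF assms(1) V(1)] by auto
  qed
qed

lemma lead_monom_eqI:
  assumes "term_order V tle" "Poly_Mapping.keys p \<subseteq> monoms V"
    and "m \<in> Poly_Mapping.keys p" "\<And>m'. m' \<in> Poly_Mapping.keys p \<Longrightarrow> tle m' m"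
  shows "lead_monom tle p = m"
  unfolding lead_monom_def using assms term_orderD(2)[OF assms(1)]
  by (intro the_equality) blast+

lemma lead_monom:
  assumes "term_order V tle" "Poly_Mapping.keys p \<subseteq> monoms V" "p \<noteq> 0"
  shows "lead_monom tle p \<in> Poly_Mapping.keys p" "\<And>m. m \<in> Poly_Mapping.keys p \<Longrightarrow> tle m (lead_monom tle p)"
proof -
  obtain m where "m \<in> Poly_Mapping.keys p" "\<forall>m'\<in>Poly_Mapping.keys p. tle m' m"
    using finite_max_monom[OF assms(1) finite_keys, of p] assms by auto
  moreover from this have "lead_monom tle p = m"
    using lead_monom_eqI[OF assms(1,2)] by blast
  ultimately show "lead_monom tle p \<in> Poly_Mapping.keys p" "\<And>m. m \<in> Poly_Mapping.keys p \<Longrightarrow> tle m (lead_monom tle p)"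
    by auto
qed

section \<open>A degree reverse lexicographic order\<close>

text \<open>Variables of larger rank are smaller in this order.\<close>

definition revlex_less ::
  "'v set \<Rightarrow> ('v \<Rightarrow> 'b::linorder) \<Rightarrow> 'v monom \<Rightarrow> 'v monom \<Rightarrow> bool" where
  "revlex_less V rk s t \<longleftrightarrow> mdeg s < mdeg t \<or> mdeg s = mdeg t \<and>
     (\<exists>v\<in>V. Poly_Mapping.lookup t v < Poly_Mapping.lookup s v \<and> (\<forall>u\<in>V. rk v < rk u \<longrightarrow> Poly_Mapping.lookup s u = Poly_Mapping.lookup t u))"

definition revlex ::
  "'v set \<Rightarrow> ('v \<Rightarrow> 'b::linorder) \<Rightarrow> 'v monom \<Rightarrow> 'v monom \<Rightarrow> bool" where
  "revlex V rk s t \<longleftrightarrow> s = t \<or> revlex_less V rk s t"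

lemma revlex_less_trans:
  assumes "inj_on rk V" "revlex_less V rk s t" "revlex_less V rk t u"
  shows "revlex_less V rk s u"
proof (cases "mdeg s = mdeg t \<and> mdeg t = mdeg u")
  case True
  obtain v where v: "v \<in> V" "Poly_Mapping.lookup t v < Poly_Mapping.lookup s v" "\<And>x. x \<in> V \<Longrightarrow> rk v < rk x \<Longrightarrow> Poly_Mapping.lookup s x = Poly_Mapping.lookup t x"
    using assms(2) True by (auto simp: revlex_less_def)
  obtain w where w: "w \<in> V" "Poly_Mapping.lookup u w < Poly_Mapping.lookup t w" "\<And>x. x \<in> V \<Longrightarrow> rk w < rk x \<Longrightarrow> Poly_Mapping.lookup t x = Poly_Mapping.lookup u x"
    using assms(3) True by (auto simp: revlex_less_def)
  have "\<exists>v\<in>V. Poly_Mapping.lookup u v < Poly_Mapping.lookup s v \<and> (\<forall>x\<in>V. rk v < rk x \<longrightarrow> Poly_Mapping.lookup s x = Poly_Mapping.lookup u x)"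
  \<comment> \<open>Of the two deciding variables, the one of higher rank decides between
    \<open>s\<close> and \<open>u\<close>.\<close>
  proof (cases "rk v" "rk w" rule: linorder_cases)
    case less
    then show ?thesis using v w by (intro bexI[of _ w]) auto
  next
    case equal
    then have "v = w" using assms(1) v w by (auto dest: inj_onD)
    then show ?thesis using v w by (intro bexI[of _ w]) auto
  next
    case greater
    then show ?thesis using v w by (intro bexI[of _ v]) auto
  qed
  then show ?thesis using True by (simp add: revlex_less_def)
qed (use assms in \<open>auto simp: revlex_less_def\<close>)

lemma revlex_less_irrefl: "\<not> revlex_less V rk s s"
  by (auto simp: revlex_less_def)

lemma revlex_less_total:
  assumes "finite V" "inj_on rk V" "s \<in> monoms V" "t \<in> monoms V" "s \<noteq> t"
  shows "revlex_less V rk s t \<or> revlex_less V rk t s"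
proof -
  \<comment> \<open>When the degrees agree, the element of highest rank in \<open>D\<close> decides
    the comparison.\<close>
  define D where "D = {v \<in> V. Poly_Mapping.lookup s v \<noteq> Poly_Mapping.lookup t v}"
  have "D \<noteq> {}"
  proof
    assume "D = {}"
    moreover have "Poly_Mapping.lookup s v = Poly_Mapping.lookup t v" if "v \<notin> V" for v
    proof -
      have "v \<notin> Poly_Mapping.keys s" "v \<notin> Poly_Mapping.keys t" using that assms(3,4) by (auto simp: monoms_def)
      then show ?thesis by (simp add: in_keys_iff)
    qed
    ultimately have "s = t" by (intro poly_mapping_eqI) (auto simp: D_def)
    then show False using assms by simp
  qed
  moreover have "finite D" using assms by (simp add: D_def)
  ultimately have "Max (rk ` D) \<in> rk ` D" by simp
  then obtain v where v: "v \<in> D" "Max (rk ` D) = rk v" by auto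
  then have "Poly_Mapping.lookup s u = Poly_Mapping.lookup t u" if "u \<in> V" "rk v < rk u" for u
    using that Max_ge[of "rk ` D" "rk u"] \<open>finite D\<close> by (force simp: D_def)
  then show ?thesis
    using v(1) unfolding revlex_less_def D_def
    by (cases "mdeg s" "mdeg t" rule: linorder_cases; cases "Poly_Mapping.lookup s v" "Poly_Mapping.lookup t v" rule: linorder_cases) auto
qed

lemma term_order_revlex:
  assumes "finite V" "inj_on rk V"
  shows "term_order V (revlex V rk)"
  unfolding term_order_def
proof (intro conjI ballI impI)
  show "revlex V rk s s" for s by (simp add: revlex_def)
  show "s = t" if "revlex V rk s t \<and> revlex V rk t s" for s t
    using that revlex_less_trans[OF assms(2), of s t s] revlex_less_irrefl[of V rk s]
    by (auto simp: revlex_def)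
  show "revlex V rk s u" if "revlex V rk s t \<and> revlex V rk t u" for s t u
    using that revlex_less_trans[OF assms(2), of s t u] by (auto simp: revlex_def)
  show "revlex V rk s t \<or> revlex V rk t s" if "s \<in> monoms V" "t \<in> monoms V" for s t
    using revlex_less_total[OF assms that] by (auto simp: revlex_def)
  show "revlex V rk 0 s" for s
    using mdeg_eq_0_iff[of s] by (auto simp: revlex_def revlex_less_def)
  show "revlex V rk (s + u) (t + u)" if "revlex V rk s t" for s t u
    using that by (auto simp: revlex_def revlex_less_def mdeg_add lookup_add)
qed

section \<open>Quadratic Groebner bases of toric ideals\<close>

text \<open>A generated ideal is the intersection of the ideals above the generating set, so it
  depends only on which ideals contain that set.\<close>

lemma Idl_eqI:
  assumes "\<And>I. ideal I R \<Longrightarrow> A \<subseteq> I \<longleftrightarrow> B \<subseteq> I"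
  shows "Idl\<^bsub>R\<^esub> A = Idl\<^bsub>R\<^esub> B"
proof -
  have "{I. ideal I R \<and> A \<subseteq> I} = {I. ideal I R \<and> B \<subseteq> I}"
    using assms by blast
  then show ?thesis by (simp add: genideal_def)
qed

text \<open>If \<open>m\<close> were the only monomial below it in its fibre, its coefficient could not cancel in the
  image.\<close>

lemma lead_monom_not_minimal:
  assumes "term_order V tle" "Poly_Mapping.keys p \<subseteq> monoms V" "p \<noteq> 0"
    and ker: "mpoly_subst of_monom p = 0"
  shows "\<exists>m'\<in>monoms V. monom_subst (\<lambda>v. v) m' = monom_subst (\<lambda>v. v) (lead_monom tle p) \<and>
           tle m' (lead_monom tle p) \<and> m' \<noteq> lead_monom tle p"
proof (rule ccontr)
  define m where "m = lead_monom tle p"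
  note lm = lead_monom[OF assms(1-3), folded m_def]
  assume "\<not> ?thesis"
  then have *: "m' = m" if "m' \<in> Poly_Mapping.keys p" "monom_subst (\<lambda>v. v) m' = monom_subst (\<lambda>v. v) m" for m'
    using that lm assms(2) unfolding m_def by blast
  have "0 = Poly_Mapping.lookup (mpoly_subst (\<lambda>v. of_monom v) p) (monom_subst (\<lambda>v. v) m)"
    using ker by simp
  also have "\<dots> = (\<Sum>m'\<in>Poly_Mapping.keys p. if m' = m then Poly_Mapping.lookup p m' else 0)"
    unfolding mpoly_subst_of_monom lookup_sum using *
    by (intro sum.cong) (auto simp: lookup_single when_def)
  also have "\<dots> = Poly_Mapping.lookup p m"
    using lm by simp
  finally show False using lm by (simp add: in_keys_iff)
qed

text \<open>In the order \<open>revlex\<close> the conclusion says that \<open>x y\<close> is the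
  leading monomial of \<open>x y - x' y'\<close>, since \<open>x'\<close> is a smaller variable than
  \<open>x\<close> and \<open>y\<close>. The rank of \<open>y'\<close> is free, and
  \<open>x = y\<close> is allowed.\<close>

definition pair_exchange :: "'u monom set \<Rightarrow> ('u monom \<Rightarrow> 'b::linorder) \<Rightarrow> bool" where
  "pair_exchange V rk \<longleftrightarrow> (\<forall>m\<in>monoms V. \<forall>w\<in>V. \<forall>r.
     monom_subst (\<lambda>v. v) m = w + r \<and> (\<forall>v\<in>Poly_Mapping.keys m. rk v < rk w) \<longrightarrow>
     (\<exists>x y x' y' m0. m = Poly_Mapping.single x 1 + Poly_Mapping.single y 1 + m0 \<and> x' \<in> V \<and> y' \<in> V \<and>
        x' + y' = x + y \<and> rk x < rk x' \<and> rk y < rk x'))"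

text \<open>Cancelling the variables that \<open>m\<close> and \<open>m'\<close> share by decreasing rank leaves a variable \<open>w\<close> of
  \<open>m'\<close> that outranks all variables of the rest of \<open>m\<close>, to which the exchange property applies.\<close>

lemma quadratic_divisor:
  fixes V :: "'u monom set" and rk :: "'u monom \<Rightarrow> 'b::linorder"
  assumes inj: "inj_on rk V" and V: "\<And>v. v \<in> V \<Longrightarrow> mdeg v = d" "d > 0"
    and exchange: "pair_exchange V rk"
    and m: "m \<in> monoms V" "m' \<in> monoms V" "monom_subst (\<lambda>v. v) m' = monom_subst (\<lambda>v. v) m"
      "revlex_less V rk m' m"
  shows "\<exists>q q' m0. m = q + m0 \<and> q' \<in> monoms V \<and> mdeg q = 2 \<and> mdeg q' = 2 \<and>
           monom_subst (\<lambda>v. v) q' = monom_subst (\<lambda>v. v) q \<and> revlex_less V rk q' q"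
proof -
  have "d * mdeg m' = d * mdeg m"
    using m(1-3) V mdeg_monom_subst[of m "\<lambda>v. v" d] mdeg_monom_subst[of m' "\<lambda>v. v" d]
    by (auto simp: monoms_def subset_iff)
  then have "mdeg m' = mdeg m" using V by simp
  then obtain w where w: "w \<in> V" "Poly_Mapping.lookup m w < Poly_Mapping.lookup m' w"
    "\<And>u. u \<in> V \<Longrightarrow> rk w < rk u \<Longrightarrow> Poly_Mapping.lookup m' u = Poly_Mapping.lookup m u"
    using m(4) by (auto simp: revlex_less_def)
  \<comment> \<open>The common part to cancel: \<open>m\<close> and \<open>m'\<close> agree above
    \<open>w\<close>, and at \<open>w\<close> the exponent in \<open>m\<close> is smaller, so
    \<open>c\<close> divides both.\<close>
  define c where "c = (\<Sum>u | u \<in> Poly_Mapping.keys m \<and> (rk w < rk u \<or> u = w). Poly_Mapping.single u (Poly_Mapping.lookup m u))"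
  have c: "Poly_Mapping.lookup c u = (if rk w < rk u \<or> u = w then Poly_Mapping.lookup m u else 0)" for u
    by (auto simp: c_def lookup_sum lookup_single when_def in_keys_iff sum.delta)
  obtain m1 where m1: "m = c + m1"
    by (rule monom_le_decomp[of c m]) (auto simp: c)
  have m1': "Poly_Mapping.lookup m1 u = (if rk w < rk u \<or> u = w then 0 else Poly_Mapping.lookup m u)" for u
    using arg_cong[OF m1, of "\<lambda>x. Poly_Mapping.lookup x u"] by (auto simp: lookup_add c)
  have "Poly_Mapping.lookup c u \<le> Poly_Mapping.lookup m' u" for u
  proof (cases "u \<in> Poly_Mapping.keys m")
    case True
    then have "u \<in> V" using m(1) by (auto simp: monoms_def)
    then show ?thesis using w by (auto simp: c)
  next
    case False
    then show ?thesis by (simp add: c in_keys_iff)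
  qed
  then obtain m2 where m2: "m' = c + m2"
    by (rule monom_le_decomp[of c m']) auto
  have "w \<in> Poly_Mapping.keys m2"
    using arg_cong[OF m2, of "\<lambda>x. Poly_Mapping.lookup x w"] w by (auto simp: lookup_add c in_keys_iff)
  then obtain m3 where m3: "m2 = Poly_Mapping.single w 1 + m3"
    by (rule in_keys_decomp)
  have "monom_subst (\<lambda>v. v) m1 = monom_subst (\<lambda>v. v) m2"
    using m(3) by (simp add: m1 m2 monom_subst_add)
  also have "\<dots> = w + monom_subst (\<lambda>v. v) m3"
    by (simp add: m3 monom_subst_add)
  finally have "monom_subst (\<lambda>v. v) m1 = w + monom_subst (\<lambda>v. v) m3" .
  moreover have "m1 \<in> monoms V" using m(1) by (simp add: m1)
  moreover have "rk v < rk w" if "v \<in> Poly_Mapping.keys m1" for v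
  proof -
    have "v \<in> V" "v \<noteq> w" "\<not> rk w < rk v"
      using that m1' \<open>m1 \<in> monoms V\<close> by (auto simp: monoms_def in_keys_iff split: if_splits)
    then show ?thesis
      using inj w(1) by (metis inj_onD linorder_neqE)
  qed
  ultimately obtain x y x' y' m0 where xy: "m1 = Poly_Mapping.single x 1 + Poly_Mapping.single y 1 + m0" "x' \<in> V" "y' \<in> V"
    "x' + y' = x + y" "rk x < rk x'" "rk y < rk x'"
    using exchange w(1) unfolding pair_exchange_def by meson
  define q where "q = Poly_Mapping.single x (1::nat) + Poly_Mapping.single y 1"
  define q' where "q' = Poly_Mapping.single x' (1::nat) + Poly_Mapping.single y' 1"
  have deg: "mdeg q = 2" "mdeg q' = 2" by (simp_all add: q_def q'_def mdeg_add)
  \<comment> \<open>As \<open>y'\<close> may outrank \<open>x'\<close>, the deciding variable is the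
    higher ranked of the two; it does not occur in \<open>q\<close>.\<close>
  define z where "z = (if rk x' < rk y' then y' else x')"
  have z: "z \<in> V" "rk x' \<le> rk z" "rk y' \<le> rk z" "z = x' \<or> z = y'"
    using xy by (auto simp: z_def)
  then have "Poly_Mapping.lookup q z < Poly_Mapping.lookup q' z"
    using xy by (auto simp: q_def q'_def lookup_add lookup_single when_def)
  moreover have "Poly_Mapping.lookup q' u = Poly_Mapping.lookup q u" if "rk z < rk u" for u
    using that z xy by (auto simp: q_def q'_def lookup_add lookup_single when_def)
  ultimately have "revlex_less V rk q' q"
    using z(1) deg by (auto simp: revlex_less_def)
  moreover have "monom_subst (\<lambda>v. v) q' = monom_subst (\<lambda>v. v) q"
    using xy by (simp add: q_def q'_def monom_subst_add)
  moreover have "m = q + (c + m0)" by (simp add: m1 xy q_def ac_simps)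
  moreover have "q' \<in> monoms V" using xy by (simp add: q'_def)
  ultimately show ?thesis using deg by blast
qed

text \<open>The leading monomial of a polynomial in the kernel is not minimal in its fibre, so by
  \<open>quadratic_divisor\<close> it is a multiple of the leading monomial of a quadratic binomial
  in the kernel. The finitely many such binomials form the basis.\<close>

lemma G_quadratic_toric:
  fixes V :: "'u monom set" and rk :: "'u monom \<Rightarrow> 'b::linorder"
  assumes "finite V" and inj: "inj_on rk V" and V: "\<And>v. v \<in> V \<Longrightarrow> mdeg v = d" "d > 0"
    and exchange: "pair_exchange V rk"
  shows "G_quadratic V {p \<in> carrier (mpoly_ring V). mpoly_subst of_monom p = (0 :: ('u, 'a::comm_ring_1) mpoly)}"
    (is "G_quadratic V ?I")
proof -
  let ?R = "mpoly_ring V :: ('u monom, 'a) mpoly ring"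
  define im where "im = monom_subst (\<lambda>v::'u monom. v)"
  \<comment> \<open>Each pair lists the larger monomial first, so \<open>q\<close> is the leading
    monomial of \<open>q - q'\<close>.\<close>
  define Q where "Q = {(q, q'). q \<in> monoms V \<and> q' \<in> monoms V \<and> mdeg q = 2 \<and> mdeg q' = 2 \<and>
    im q' = im q \<and> revlex_less V rk q' q}"
  define B where "B = (\<lambda>(q, q'). of_monom q - of_monom q' :: ('u monom, 'a) mpoly) ` Q"
  have to: "term_order V (revlex V rk)"
    by (rule term_order_revlex[OF assms(1,2)])
  have keys: "Poly_Mapping.keys (of_monom q - of_monom q' :: ('u monom, 'a) mpoly) = {q, q'}"
    if "(q, q') \<in> Q" for q q'
    using that revlex_less_irrefl[of V rk q]
    by (auto simp: Q_def of_monom_def in_keys_iff lookup_minus lookup_single when_def split: if_splits)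
  have lead: "lead_monom (revlex V rk) (of_monom q - of_monom q' :: ('u monom, 'a) mpoly) = q"
    if "(q, q') \<in> Q" for q q'
    using that keys[OF that] by (intro lead_monom_eqI[OF to]) (auto simp: Q_def revlex_def)
  have "finite B"
  proof -
    have "Q \<subseteq> {m \<in> monoms V. mdeg m = 2} \<times> {m \<in> monoms V. mdeg m = 2}"
      by (auto simp: Q_def)
    then have "finite Q"
      by (rule finite_subset) (simp add: finite_monoms_mdeg[OF \<open>finite V\<close>])
    then show ?thesis by (simp add: B_def)
  qed
  moreover have BI: "B \<subseteq> ?I - {0}"
  proof
    fix b assume "b \<in> B"
    then obtain q q' where q: "(q, q') \<in> Q" "b = of_monom q - of_monom q'"
      by (auto simp: B_def)
    have ne: "q \<noteq> q'" using q revlex_less_irrefl[of V rk q] by (auto simp: Q_def)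
    have "mpoly_subst of_monom b = Poly_Mapping.single (im q) (Poly_Mapping.lookup b q) + Poly_Mapping.single (im q') (Poly_Mapping.lookup b q')"
      using mpoly_subst_of_monom[of "\<lambda>v. v" b] ne keys[OF q(1)] by (simp add: im_def q(2))
    also have "\<dots> = Poly_Mapping.single (im q) (Poly_Mapping.lookup b q + Poly_Mapping.lookup b q')"
      using q(1) by (simp add: Q_def single_add)
    also have "\<dots> = 0"
      using ne by (simp add: q(2) of_monom_def lookup_minus lookup_single)
    finally have "mpoly_subst of_monom b = 0" .
    moreover have "b \<in> carrier ?R"
      using keys[OF q(1)] q by (auto simp: mpoly_ring_def Q_def)
    moreover have "b \<noteq> 0" using keys[OF q(1)] q by auto
    ultimately show "b \<in> ?I - {0}" by simp
  qed
  moreover have "initial_ideal V (revlex V rk) B = initial_ideal V (revlex V rk) ?I"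
    unfolding initial_ideal_def
  proof (rule Idl_eqI)
    fix J :: "('u monom, 'a) mpoly set"
    assume "ideal J ?R"
    then interpret J: ideal J ?R .
    show "{of_monom (lead_monom (revlex V rk) p) |p. p \<in> B \<and> p \<noteq> 0} \<subseteq> J \<longleftrightarrow>
      {of_monom (lead_monom (revlex V rk) p) |p. p \<in> ?I \<and> p \<noteq> 0} \<subseteq> J" (is "?LB \<subseteq> J \<longleftrightarrow> ?LI \<subseteq> J")
    proof
      assume LB: "?LB \<subseteq> J"
      show "?LI \<subseteq> J"
      proof
        fix f assume "f \<in> ?LI"
        then obtain p where p: "p \<in> ?I" "p \<noteq> 0" "f = of_monom (lead_monom (revlex V rk) p)"
          by auto
        define m where "m = lead_monom (revlex V rk) p"
        have pV: "Poly_Mapping.keys p \<subseteq> monoms V" using p by (simp add: mpoly_ring_def)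
        have m: "m \<in> monoms V" using lead_monom(1)[OF to pV p(2)] pV by (auto simp: m_def)
        obtain m' where m': "m' \<in> monoms V" "im m' = im m" "revlex_less V rk m' m"
          using lead_monom_not_minimal[OF to pV p(2)] p(1) by (auto simp: revlex_def im_def m_def)
        obtain q q' m0 where q: "m = q + m0" "q' \<in> monoms V" "mdeg q = 2" "mdeg q' = 2"
            "im q' = im q" "revlex_less V rk q' q"
          using quadratic_divisor[OF inj V exchange m m'[unfolded im_def]]
          unfolding im_def by metis
        then have "(q, q') \<in> Q" using m by (simp add: Q_def)
        then have "of_monom q \<in> ?LB"
          using lead BI unfolding B_def by (intro CollectI exI[of _ "of_monom q - of_monom q'"]) auto
        then have "of_monom q \<in> J" using LB by blast
        moreover have "of_monom m0 \<in> carrier ?R"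
          using m q(1) by (simp add: mpoly_ring_def of_monom_def)
        ultimately have "of_monom m0 * of_monom q \<in> J"
          using J.I_l_closed by (simp add: mpoly_ring_def)
        then show "f \<in> J" by (simp add: p(3) m_def[symmetric] q(1) of_monom_add mult.commute)
      qed
    qed (use BI in blast)
  qed
  moreover have "\<forall>b\<in>B. homogeneous 2 b"
    using keys by (auto simp: B_def homogeneous_def Q_def)
  moreover have "in_coordinates V mvar ?I = ?I"
    by (rule in_coordinates_mvar) auto
  ultimately show ?thesis
    unfolding G_quadratic_def groebner_basis_def using coordinate_system_mvar[of V] to
    by (intro exI[of _ mvar] exI[of _ "revlex V rk"] exI[of _ B]) simp
qed

section \<open>Monomials invariant under a cyclic diagonal group\<close>

lemma diag_act_of_monom:
  "diag_act g (of_monom m) = mconst (\<Prod>i\<in>Poly_Mapping.keys m. (g $$ (i, i)) ^ Poly_Mapping.lookup m i) * of_monom m"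
proof -
  have "diag_act g (of_monom m) = (\<Prod>i\<in>Poly_Mapping.keys m. mconst ((g $$ (i, i)) ^ Poly_Mapping.lookup m i) * mvar i ^ Poly_Mapping.lookup m i)"
    by (simp add: diag_act_def mpoly_subst_on_monom power_mult_distrib mconst_power)
  also have "\<dots> = mconst (\<Prod>i\<in>Poly_Mapping.keys m. (g $$ (i, i)) ^ Poly_Mapping.lookup m i) * (\<Prod>i\<in>Poly_Mapping.keys m. mvar i ^ Poly_Mapping.lookup m i)"
    by (simp add: prod.distrib mconst_prod)
  also have "(\<Prod>i\<in>Poly_Mapping.keys m. mvar i ^ Poly_Mapping.lookup m i) = of_monom m"
    using prod_of_monom_power[of "\<lambda>v. Poly_Mapping.single v 1" m] by (simp add: mvar_def)
  finally show ?thesis .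
qed

lemma diag_act_of_monom_eq_iff:
  fixes g :: "'a::field mat"
  shows "diag_act g (of_monom m) = of_monom m \<longleftrightarrow> (\<Prod>i\<in>Poly_Mapping.keys m. (g $$ (i, i)) ^ Poly_Mapping.lookup m i) = 1"
proof -
  have "Poly_Mapping.single m c = Poly_Mapping.single m (1::'a) \<longleftrightarrow> c = 1" for c
    by (metis lookup_single_eq)
  then show ?thesis
    unfolding diag_act_of_monom mconst_times_of_monom by (simp add: of_monom_def)
qed

text \<open>Diagonality is asked of the right factor only, so that the formula applies to the
  product of an inverse with \<open>M\<close> before the inverse is known to be diagonal.\<close>

lemma mult_diag_entries:
  fixes A :: "'a::field mat"
  assumes "A \<in> carrier_mat N N" "B \<in> carrier_mat N N" "i < N" "j < N" "diagonal_mat B"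
  shows "(A * B) $$ (i, j) = A $$ (i, j) * B $$ (j, j)"
proof -
  have "(A * B) $$ (i, j) = (\<Sum>k<N. A $$ (i, k) * B $$ (k, j))"
    using assms by (simp add: scalar_prod_def lessThan_atLeast0)
  also have "\<dots> = (\<Sum>k<N. if k = j then A $$ (i, j) * B $$ (j, j) else 0)"
    using assms by (intro sum.cong) (auto simp: diagonal_mat_def)
  finally show ?thesis using assms by simp
qed

text \<open>On diagonal matrices the eigenvalue of a monomial is multiplicative. The induction over
  \<open>generate\<close> therefore carries diagonality and membership in \<open>GL N\<close> along
  with the eigenvalue 1.\<close>

lemma generate_diag_invariant:
  fixes M :: "'a::field mat"
  assumes M: "M \<in> carrier (GL N)" "diagonal_mat M" and m: "Poly_Mapping.keys m \<subseteq> {..<N}"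
    and inv: "(\<Prod>i\<in>Poly_Mapping.keys m. (M $$ (i, i)) ^ Poly_Mapping.lookup m i) = 1"
    and g: "g \<in> generate (GL N) {M}"
  shows "(\<Prod>i\<in>Poly_Mapping.keys m. (g $$ (i, i)) ^ Poly_Mapping.lookup m i) = 1"
proof -
  interpret R: ring "ring_mat TYPE('a) N ()" by (rule ring_mat)
  interpret G: group "GL N :: 'a mat monoid" unfolding GL_def by (rule R.units_group)
  have car: "A \<in> carrier_mat N N" if "A \<in> carrier (GL N)" for A :: "'a mat"
    using that by (auto simp: GL_def units_of_def Units_def ring_mat_simps)
  have mult: "A \<otimes>\<^bsub>GL N\<^esub> B = A * B" and one_eq: "\<one>\<^bsub>GL N\<^esub> = 1\<^sub>m N" for A B :: "'a mat"
    by (simp_all add: GL_def units_of_def ring_mat_simps)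
  have "g \<in> carrier (GL N) \<and> diagonal_mat g \<and> (\<Prod>i\<in>Poly_Mapping.keys m. (g $$ (i, i)) ^ Poly_Mapping.lookup m i) = 1"
    using g
  proof induction
    case one
    have "(\<Prod>i\<in>Poly_Mapping.keys m. (1\<^sub>m N $$ (i, i)) ^ Poly_Mapping.lookup m i) = (1::'a)"
      using m by (intro prod.neutral) auto
    then show ?case using G.one_closed by (auto simp: one_eq diagonal_mat_def)
  next
    case (incl h)
    then show ?case using M inv by simp
  next
    case (inv h)
    define A where "A = inv\<^bsub>GL N\<^esub> M"
    have A: "A \<in> carrier (GL N)" "A * M = 1\<^sub>m N"
      using G.inv_closed[OF M(1)] G.l_inv[OF M(1)] by (simp_all add: A_def mult one_eq)
    \<comment> \<open>Entrywise form of \<open>A * M = 1\<close>: the diagonal entries of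
      \<open>M\<close> cannot vanish, and then the entries of \<open>A\<close> off the diagonal
      must.\<close>
    have e: "A $$ (i, j) * M $$ (j, j) = 1\<^sub>m N $$ (i, j)" if "i < N" "j < N" for i j
      using mult_diag_entries[OF car[OF A(1)] car[OF M(1)] that M(2)] A(2) by simp
    have nz: "M $$ (j, j) \<noteq> 0" if "j < N" for j
      using e[OF that that] that by auto
    have "diagonal_mat A"
      using e nz car[OF A(1)] unfolding diagonal_mat_def
      by (metis carrier_matD index_one_mat(1) mult_eq_0_iff)
    moreover have "(\<Prod>i\<in>Poly_Mapping.keys m. (A $$ (i, i)) ^ Poly_Mapping.lookup m i) = 1"
    proof -
      have "(\<Prod>i\<in>Poly_Mapping.keys m. (A $$ (i, i)) ^ Poly_Mapping.lookup m i) * (\<Prod>i\<in>Poly_Mapping.keys m. (M $$ (i, i)) ^ Poly_Mapping.lookup m i) =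
          (\<Prod>i\<in>Poly_Mapping.keys m. (A $$ (i, i) * M $$ (i, i)) ^ Poly_Mapping.lookup m i)"
        by (simp add: prod.distrib power_mult_distrib)
      also have "\<dots> = 1"
        using e m by (intro prod.neutral) auto
      finally show ?thesis using assms(4) by simp
    qed
    ultimately show ?case using inv A by (simp add: A_def)
  next
    case (eng g h)
    have *: "(g * h) $$ (i, j) = g $$ (i, j) * h $$ (j, j)" if "i < N" "j < N" for i j
      using mult_diag_entries[of g N h i j] that eng car by auto
    have "diagonal_mat (g * h)"
      using * eng car[of g] car[of h] unfolding diagonal_mat_def by auto
    moreover have "(\<Prod>i\<in>Poly_Mapping.keys m. ((g * h) $$ (i, i)) ^ Poly_Mapping.lookup m i) =
        (\<Prod>i\<in>Poly_Mapping.keys m. (g $$ (i, i)) ^ Poly_Mapping.lookup m i) * (\<Prod>i\<in>Poly_Mapping.keys m. (h $$ (i, i)) ^ Poly_Mapping.lookup m i)"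
      unfolding prod.distrib[symmetric] power_mult_distrib[symmetric]
      using m * by (intro prod.cong) auto
    ultimately show ?case using eng G.m_closed[of g h] by (simp add: mult)
  qed
  then show ?thesis by simp
qed

text \<open>Invariance passes from the generator to the group, which in turn contains the
  generator.\<close>

lemma invariant_monoms_generate:
  fixes M :: "'a::field mat"
  assumes "M \<in> carrier (GL (n + 1))" "diagonal_mat M"
  shows "invariant_monoms n d (generate (GL (n + 1)) {M}) =
    {m \<in> monoms {0..n}. mdeg m = d \<and> (\<Prod>i\<in>Poly_Mapping.keys m. (M $$ (i, i)) ^ Poly_Mapping.lookup m i) = 1}"
proof -
  have "Poly_Mapping.keys m \<subseteq> {..<n + 1}" if "m \<in> monoms {0..n}" for m :: "nat monom"
    using that by (auto simp: monoms_def)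
  then show ?thesis
    unfolding invariant_monoms_def diag_act_of_monom_eq_iff
    using generate_diag_invariant[OF assms] generate.incl[of M "{M}"] by blast
qed

section \<open>Powers of the root of unity and eigenvalues of the block matrices\<close>

lemma primitive_root_powi_eq_1_iff:
  assumes "primitive_root_of_unity d e" "d > 0"
  shows "e powi k = 1 \<longleftrightarrow> int d dvd k"
proof -
  have e: "e ^ d = 1" "\<And>j. 0 < j \<Longrightarrow> j < d \<Longrightarrow> e ^ j \<noteq> 1"
    using assms by (auto simp: primitive_root_of_unity_def)
  have "e \<noteq> 0" using e(1) assms(2) by (auto simp: power_0_left)
  \<comment> \<open>The remainder is nonnegative even for negative \<open>k\<close>, so
    \<open>e powi k\<close> becomes an ordinary power with exponent below \<open>d\<close>.\<close>
  define j where "j = nat (k mod int d)"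
  have j: "int j = k mod int d" "j < d" using assms(2) by (simp_all add: j_def nat_less_iff)
  have "e powi k = e powi (int d * (k div int d) + k mod int d)" by simp
  also have "\<dots> = (e ^ d) powi (k div int d) * e ^ j"
    using \<open>e \<noteq> 0\<close> by (simp only: power_int_add power_int_mult j(1)[symmetric] power_int_of_nat simp_thms)
  also have "\<dots> = e ^ j" by (simp add: e(1))
  finally have "e powi k = 1 \<longleftrightarrow> j = 0" using e(2) j(2) by (cases "j = 0") auto
  also have "\<dots> \<longleftrightarrow> int d dvd k" using j(1) by (simp add: dvd_eq_mod_eq_0) linarith
  finally show ?thesis .
qed

definition block_deg :: "nat set \<Rightarrow> nat monom \<Rightarrow> nat" where
  "block_deg S a = (\<Sum>i\<in>S. Poly_Mapping.lookup a i)"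

text \<open>The inverse has the negated exponents; one identity, taken at both signs, shows that it
  is a two-sided inverse.\<close>

lemma diag_M_in_GL:
  assumes "e \<noteq> 0"
  shows "diag_M e l0 l1 l2 \<alpha> \<beta> \<in> carrier (GL (l0 + l1 + l2))"
proof -
  have *: "diag_M e l0 l1 l2 a b * diag_M e l0 l1 l2 (- a) (- b) = 1\<^sub>m (l0 + l1 + l2)" for a b
  proof -
    have "(\<lambda>i. (if i < l0 then 1 else if i < l0 + l1 then e powi a else e powi b) *
       (if i < l0 then 1 else if i < l0 + l1 then e powi - a else e powi - b)) = (\<lambda>i. 1)"
      using assms by (auto simp: power_int_minus)
    then show ?thesis by (simp only: diag_M_def mat_diag_diag mat_diag_one)
  qed
  have "diag_M e l0 l1 l2 a b \<in> carrier_mat (l0 + l1 + l2) (l0 + l1 + l2)" for a b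
    by (simp add: diag_M_def)
  with *[of \<alpha> \<beta>] *[of "- \<alpha>" "- \<beta>"] show ?thesis
    unfolding GL_def units_of_def Units_def ring_mat_simps by auto
qed

text \<open>Indices that do not occur in \<open>m\<close> contribute a zeroth power, so the product
  may run over all indices and split along the three blocks, of which the first contributes
  1.\<close>

lemma prod_diag_M:
  assumes "e \<noteq> 0" "Poly_Mapping.keys m \<subseteq> {..<l0 + l1 + l2}"
  shows "(\<Prod>i\<in>Poly_Mapping.keys m. (diag_M e l0 l1 l2 \<alpha> \<beta> $$ (i, i)) ^ Poly_Mapping.lookup m i) =
    e powi (\<alpha> * int (block_deg {l0..<l0 + l1} m) + \<beta> * int (block_deg {l0 + l1..<l0 + l1 + l2} m))"
proof -
  let ?f = "\<lambda>i. if i < l0 then 1 else if i < l0 + l1 then e powi \<alpha> else e powi \<beta>"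
  have pw: "(\<Prod>i\<in>S. (e powi a) ^ Poly_Mapping.lookup m i) = e powi (a * int (block_deg S m))" for a S
    by (simp add: block_deg_def power_sum[symmetric] power_int_mult del: of_nat_sum)
  have "(\<Prod>i\<in>Poly_Mapping.keys m. (diag_M e l0 l1 l2 \<alpha> \<beta> $$ (i, i)) ^ Poly_Mapping.lookup m i) = (\<Prod>i\<in>Poly_Mapping.keys m. ?f i ^ Poly_Mapping.lookup m i)"
    using assms(2) by (intro prod.cong) (auto simp: diag_M_def mat_diag_def)
  also have "\<dots> = (\<Prod>i<l0 + l1 + l2. ?f i ^ Poly_Mapping.lookup m i)"
    using assms(2) by (intro prod.mono_neutral_left) (auto simp: in_keys_iff)
  also have "\<dots> = (\<Prod>i<l0. ?f i ^ Poly_Mapping.lookup m i) * (\<Prod>i\<in>{l0..<l0 + l1}. ?f i ^ Poly_Mapping.lookup m i) *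
      (\<Prod>i\<in>{l0 + l1..<l0 + l1 + l2}. ?f i ^ Poly_Mapping.lookup m i)"
    using prod.atLeastLessThan_concat[of 0 l0 "l0 + l1" "\<lambda>i. ?f i ^ Poly_Mapping.lookup m i"]
      prod.atLeastLessThan_concat[of 0 "l0 + l1" "l0 + l1 + l2" "\<lambda>i. ?f i ^ Poly_Mapping.lookup m i"]
    by (simp only: lessThan_atLeast0 le0 le_add1)
  also have "(\<Prod>i<l0. ?f i ^ Poly_Mapping.lookup m i) = 1" by (intro prod.neutral) auto
  also have "(\<Prod>i\<in>{l0..<l0 + l1}. ?f i ^ Poly_Mapping.lookup m i) = e powi (\<alpha> * int (block_deg {l0..<l0 + l1} m))"
    unfolding pw[symmetric] by (intro prod.cong) auto
  also have "(\<Prod>i\<in>{l0 + l1..<l0 + l1 + l2}. ?f i ^ Poly_Mapping.lookup m i) =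
      e powi (\<beta> * int (block_deg {l0 + l1..<l0 + l1 + l2} m))"
    unfolding pw[symmetric] by (intro prod.cong) auto
  finally show ?thesis using assms(1) by (simp add: power_int_add)
qed

section \<open>Monomials in three blocks of variables\<close>

lemma block_deg_add: "block_deg S (a + b) = block_deg S a + block_deg S b"
  by (simp add: block_deg_def lookup_add sum.distrib)

lemma block_deg_single: "finite S \<Longrightarrow> block_deg S (Poly_Mapping.single i k) = (if i \<in> S then k else 0)"
  by (simp add: block_deg_def lookup_single when_def sum.delta)

lemma block_deg_disjoint:
  assumes "Poly_Mapping.keys p \<subseteq> S" "S \<inter> T = {}"
  shows "block_deg T p = 0"
  unfolding block_deg_def using assms by (intro sum.neutral) (auto simp: in_keys_iff)

lemma lookup_le_block_deg: "finite S \<Longrightarrow> i \<in> S \<Longrightarrow> Poly_Mapping.lookup a i \<le> block_deg S a"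
  by (simp add: block_deg_def member_le_sum)

lemma block_deg_pos: "block_deg S a > 0 \<Longrightarrow> \<exists>i\<in>S. Poly_Mapping.lookup a i > 0"
  by (rule ccontr) (auto simp: block_deg_def)

text \<open>Letters of \<open>S\<close> are moved from the rest to \<open>p\<close> one at a
  time.\<close>

lemma split_block:
  assumes "finite S" "k \<le> block_deg S a"
  shows "\<exists>p r. a = p + r \<and> Poly_Mapping.keys p \<subseteq> S \<and> block_deg S p = k"
  using assms(2)
proof (induction k)
  case 0
  show ?case by (intro exI[of _ 0] exI[of _ a]) (simp add: block_deg_def)
next
  case (Suc k)
  then obtain p r where p: "a = p + r" "Poly_Mapping.keys p \<subseteq> S" "block_deg S p = k" by auto
  then have "block_deg S r > 0" using Suc.prems by (simp add: block_deg_add)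
  then obtain i where i: "i \<in> S" "i \<in> Poly_Mapping.keys r" using block_deg_pos by (auto simp: in_keys_iff)
  obtain r' where r': "r = Poly_Mapping.single i 1 + r'" by (rule in_keys_decomp[OF i(2)])
  then show ?case
    using p i assms(1) r'
    by (intro exI[of _ "p + Poly_Mapping.single i 1"] exI[of _ r'])
       (auto simp: block_deg_add block_deg_single keys_add_nat ac_simps)
qed

text \<open>The order on exponent vectors is the lexicographic one in which variables of smaller
  index weigh more.\<close>

lemma monom_less_iff:
  "v < w \<longleftrightarrow> (\<exists>i. Poly_Mapping.lookup v i < Poly_Mapping.lookup w i \<and> (\<forall>j<i. Poly_Mapping.lookup v j = Poly_Mapping.lookup w j))" for v w :: "nat monom"
  by (simp add: less_poly_mapping.rep_eq less_fun_def)

text \<open>The smallest letter of \<open>p\<close> is the first index where the two sides differ,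
  as all letters of \<open>q\<close> come later.\<close>

lemma exchange_less:
  fixes p q v0 :: "nat monom"
  assumes "Poly_Mapping.keys p \<noteq> {}" "\<And>i j. i \<in> Poly_Mapping.keys p \<Longrightarrow> j \<in> Poly_Mapping.keys q \<Longrightarrow> i < j"
  shows "q + v0 < p + v0"
proof -
  define i where "i = Min (Poly_Mapping.keys p)"
  have i: "i \<in> Poly_Mapping.keys p" "\<And>j. j \<in> Poly_Mapping.keys p \<Longrightarrow> i \<le> j"
    using assms(1) by (auto simp: i_def)
  have q: "Poly_Mapping.lookup q j = 0" if "j \<le> i" for j
    using assms(2)[OF i(1), of j] that by (meson in_keys_iff linorder_not_less)
  have p: "Poly_Mapping.lookup p j = 0" if "j < i" for j
    using i(2)[of j] that by (meson in_keys_iff linorder_not_less)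
  show ?thesis
    unfolding monom_less_iff using i(1) p q
    by (intro exI[of _ i]) (auto simp: lookup_add in_keys_iff)
qed

text \<open>Since \<open>v\<close> falls short of \<open>w\<close> at \<open>i\<close> but not in
  total degree on \<open>S\<close>, it contains a letter \<open>j > i\<close> of \<open>S\<close>.
  Exchanging this \<open>j\<close> for a letter \<open>i\<close> of \<open>x\<close> raises
  \<open>v\<close> and keeps the degrees in all blocks.\<close>

lemma swap_in_block:
  fixes v w x :: "nat monom"
  assumes "finite S" "i \<in> S" and w: "Poly_Mapping.lookup v i < Poly_Mapping.lookup w i" "\<forall>j<i. Poly_Mapping.lookup v j = Poly_Mapping.lookup w j"
    and deg: "block_deg S w \<le> block_deg S v" and x: "Poly_Mapping.lookup x i > 0"
  obtains v' x' where "v' + x' = v + x" "v < v'" "Poly_Mapping.keys v' \<subseteq> Poly_Mapping.keys v \<union> S" "Poly_Mapping.keys x' \<subseteq> Poly_Mapping.keys x \<union> S"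
    "\<forall>T. finite T \<and> (S = T \<or> S \<inter> T = {}) \<longrightarrow> block_deg T v' = block_deg T v"
    "\<forall>T. finite T \<and> (S = T \<or> S \<inter> T = {}) \<longrightarrow> block_deg T x' = block_deg T x"
proof -
  have "\<exists>j\<in>S. i < j \<and> Poly_Mapping.lookup v j > 0"
  proof (rule ccontr)
    assume "\<not> ?thesis"
    then have "Poly_Mapping.lookup v j \<le> Poly_Mapping.lookup w j" if "j \<in> S" for j
      using that w by (cases j i rule: linorder_cases) auto
    then have "block_deg S v < block_deg S w"
      unfolding block_deg_def using assms(1,2) w(1) by (intro sum_strict_mono_ex1) auto
    then show False using deg by simp
  qed
  then obtain j where j: "j \<in> S" "i < j" "j \<in> Poly_Mapping.keys v" by (auto simp: in_keys_iff)
  obtain v0 where v0: "v = Poly_Mapping.single j 1 + v0" by (rule in_keys_decomp[OF j(3)])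
  obtain x0 where x0: "x = Poly_Mapping.single i 1 + x0" by (rule in_keys_decomp[of i x]) (use x in \<open>simp add: in_keys_iff\<close>)
  have "v < Poly_Mapping.single i 1 + v0"
    unfolding v0 using j(2) by (intro exchange_less) auto
  then show thesis
    using j(1) assms(2)
    by (intro that[of "Poly_Mapping.single i 1 + v0" "Poly_Mapping.single j 1 + x0"])
       (auto simp: v0 x0 keys_add_nat block_deg_add block_deg_single ac_simps)
qed

section \<open>Generators described by their block degrees\<close>

lemma block_deg_sum:
  assumes "Poly_Mapping.keys a \<subseteq> {0..<l0 + l1 + l2}"
  shows "mdeg a = block_deg {0..<l0} a + block_deg {l0..<l0 + l1} a + block_deg {l0 + l1..<l0 + l1 + l2} a"
  using mdeg_eq_sum[OF _ assms]
    sum.atLeastLessThan_concat[of 0 l0 "l0 + l1" "Poly_Mapping.lookup a"]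
    sum.atLeastLessThan_concat[of 0 "l0 + l1" "l0 + l1 + l2" "Poly_Mapping.lookup a"]
  by (simp add: block_deg_def)

lemma block_deg_monom_subst:
  "block_deg S (monom_subst (\<lambda>v. v) m) = (\<Sum>x\<in>Poly_Mapping.keys m. Poly_Mapping.lookup m x * block_deg S x)"
  unfolding block_deg_def lookup_monom_subst by (subst sum.swap) (simp add: sum_distrib_left)

text \<open>\<open>P\<close> sees the degrees in the last two blocks only; the degree in the first
  block is what they leave of \<open>d\<close>.\<close>

definition block_monoms :: "nat \<Rightarrow> nat \<Rightarrow> nat \<Rightarrow> nat \<Rightarrow> (nat \<Rightarrow> nat \<Rightarrow> bool) \<Rightarrow> nat monom set" where
  "block_monoms l0 l1 l2 d P = {a. Poly_Mapping.keys a \<subseteq> {0..<l0 + l1 + l2} \<and> mdeg a = d \<and>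
     P (block_deg {l0..<l0 + l1} a) (block_deg {l0 + l1..<l0 + l1 + l2} a)}"

text \<open>Reduces the exchange property to the highest ranked variable \<open>v\<close> of the monomial.\<close>

lemma pair_exchangeI:
  fixes W :: "nat monom set" and \<kappa> :: "nat monom \<Rightarrow> bool"
  defines "rk \<equiv> \<lambda>a. (\<kappa> a, a)"
  assumes deg: "\<And>a. a \<in> W \<Longrightarrow> mdeg a = d" "d > 0"
    and step: "\<And>v w m r. v \<in> W \<Longrightarrow> w \<in> W \<Longrightarrow> m \<in> monoms W \<Longrightarrow> m \<noteq> 0 \<Longrightarrow>
      v + monom_subst (\<lambda>v. v) m = w + r \<Longrightarrow> rk v < rk w \<Longrightarrow> (\<And>x. x \<in> Poly_Mapping.keys m \<Longrightarrow> \<kappa> x \<Longrightarrow> \<kappa> v) \<Longrightarrow>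
      (\<exists>x y x' y' m0. Poly_Mapping.single v 1 + m = Poly_Mapping.single x 1 + Poly_Mapping.single y 1 + m0 \<and> x' \<in> W \<and> y' \<in> W \<and>
         x' + y' = x + y \<and> \<not> \<kappa> x \<and> \<not> \<kappa> y \<and> \<kappa> x') \<or>
      (\<exists>x\<in>Poly_Mapping.keys m. \<exists>x'\<in>W. \<exists>y'\<in>W. x' + y' = v + x \<and> rk v < rk x')"
  shows "pair_exchange W rk"
  unfolding pair_exchange_def
proof (intro ballI allI impI, elim conjE)
  fix m w r
  assume m: "m \<in> monoms W" "w \<in> W" "monom_subst (\<lambda>v. v) m = w + r" and lt: "\<forall>v\<in>Poly_Mapping.keys m. rk v < rk w"
  have "m \<noteq> 0"
  proof
    assume "m = 0"
    then have "monom_subst (\<lambda>v. v) m = 0" by (simp add: monom_subst_def)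
    then have "mdeg (w + r) = 0" unfolding m(3) by simp
    then show False using deg m(2) by (simp add: mdeg_add)
  qed
  then have "Max (rk ` Poly_Mapping.keys m) \<in> rk ` Poly_Mapping.keys m" by simp
  then obtain v where v: "v \<in> Poly_Mapping.keys m" "Max (rk ` Poly_Mapping.keys m) = rk v" by auto
  have max: "rk x \<le> rk v" if "x \<in> Poly_Mapping.keys m" for x
    unfolding v(2)[symmetric] using that by simp
  obtain m1 where m1: "m = Poly_Mapping.single v 1 + m1" by (rule in_keys_decomp[OF v(1)])
  have vW: "v \<in> W" "m1 \<in> monoms W" using m(1) v(1) m1 by (auto simp: monoms_def keys_add_nat)
  have eq: "v + monom_subst (\<lambda>v. v) m1 = w + r" using m(3) by (simp add: m1 monom_subst_add)
  \<comment> \<open>A single variable \<open>v\<close> divisible by \<open>w\<close> would equal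
    \<open>w\<close>, both having degree \<open>d\<close>, against the strict rank
    inequality.\<close>
  have "m1 \<noteq> 0"
  proof
    assume "m1 = 0"
    then have "v = w + r" using eq by (simp add: monom_subst_def)
    moreover from this have "mdeg r = 0" using deg(1)[OF vW(1)] deg(1)[OF m(2)] by (simp add: mdeg_add)
    ultimately have "v = w" by (simp add: mdeg_eq_0_iff)
    then show False using lt v(1) by auto
  qed
  \<comment> \<open>The rank is ordered lexicographically with \<open>False < True\<close> in its
    first component, so the maximal \<open>v\<close> is special as soon as some factor is.\<close>
  moreover have "\<kappa> v" if "x \<in> Poly_Mapping.keys m1" "\<kappa> x" for x
    using max[of x] that m1 by (auto simp: rk_def keys_add_nat)
  ultimately consider
    (pair) x y x' y' m0 where "m = Poly_Mapping.single x 1 + Poly_Mapping.single y 1 + m0" "x' \<in> W" "y' \<in> W"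
         "x' + y' = x + y" "\<not> \<kappa> x" "\<not> \<kappa> y" "\<kappa> x'"
    | (top) x x' y' where "x \<in> Poly_Mapping.keys m1" "x' \<in> W" "y' \<in> W" "x' + y' = v + x" "rk v < rk x'"
    using step[OF vW(1) m(2) vW(2) _ eq] lt v(1) unfolding m1 by blast
  then show "\<exists>x y x' y' m0. m = Poly_Mapping.single x 1 + Poly_Mapping.single y 1 + m0 \<and> x' \<in> W \<and> y' \<in> W \<and>
            x' + y' = x + y \<and> rk x < rk x' \<and> rk y < rk x'"
  proof cases
    case pair
    then show ?thesis by (intro exI[of _ x] exI[of _ y] exI[of _ x'] exI[of _ y'] exI[of _ m0]) (simp add: rk_def)
  next
    case top
    obtain m0 where m0: "m1 = Poly_Mapping.single x 1 + m0" by (rule in_keys_decomp[OF top(1)])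
    have "rk x < rk x'" using max[of x] top m1 by (auto simp: keys_add_nat)
    then show ?thesis using top m0 m1
      by (intro exI[of _ v] exI[of _ x] exI[of _ x'] exI[of _ y'] exI[of _ m0]) (simp add: ac_simps)
  qed
qed

text \<open>The letters \<open>i\<close> of \<open>w\<close> that \<open>v\<close> cannot supply
  must come from another factor.\<close>

lemma lookup_first_diff:
  assumes "v + monom_subst (\<lambda>v. v) m = w + r" "Poly_Mapping.lookup v i < Poly_Mapping.lookup w i"
  shows "\<exists>x\<in>Poly_Mapping.keys m. Poly_Mapping.lookup x i > 0"
proof (rule ccontr)
  assume "\<not> ?thesis"
  then have "Poly_Mapping.lookup (monom_subst (\<lambda>v. v) m) i = 0"
    by (auto simp: lookup_monom_subst)
  then show False
    using arg_cong[OF assms(1), of "\<lambda>a. Poly_Mapping.lookup a i"] assms(2) by (simp add: lookup_add)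
qed

text \<open>The remainders of \<open>s0\<close>, \<open>s1\<close>, \<open>s2\<close> modulo \<open>c\<close> sum to less than \<open>3 c\<close>.\<close>

lemma split_multiples:
  fixes s0 s1 s2 c g :: nat
  assumes "s0 + s1 + s2 = 2 * (g * c)" "g \<ge> 2" "c > 0"
  shows "\<exists>k0 k1 k2. k0 + k1 + k2 = g \<and> c * k0 \<le> s0 \<and> c * k1 \<le> s1 \<and> c * k2 \<le> s2"
proof -
  have "2 * (g * c) = c * (s0 div c) + c * (s1 div c) + c * (s2 div c) + (s0 mod c + s1 mod c + s2 mod c)"
    unfolding assms(1)[symmetric]
    using mult_div_mod_eq[of c s0] mult_div_mod_eq[of c s1] mult_div_mod_eq[of c s2] by linarith
  moreover have "s0 mod c < c" "s1 mod c < c" "s2 mod c < c" using assms(3) by auto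
  ultimately have "c * (2 * g) < c * (s0 div c + s1 div c + s2 div c + 3)"
    unfolding distrib_left by (simp only: mult.left_commute[of c 2] mult.commute[of c g] mult.commute[of c 3])
  then have "2 * g < s0 div c + s1 div c + s2 div c + 3" using assms(3) by simp
  \<comment> \<open>The sum of the quotients is at least \<open>2 * g - 2\<close>, and this is at
    least \<open>g\<close> because \<open>g \<ge> 2\<close>.\<close>
  then have ge: "g \<le> s0 div c + s1 div c + s2 div c" using assms(2) by linarith
  \<comment> \<open>Greedy choice: as much as possible from \<open>s0\<close>, then from
    \<open>s1\<close>; by \<open>ge\<close> the quotient of \<open>s2\<close> covers the
    rest.\<close>
  define k0 where "k0 = min g (s0 div c)"
  define k1 where "k1 = min (g - k0) (s1 div c)"
  have le: "c * k \<le> s" if "k \<le> s div c" for k s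
    by (meson le_trans mult_le_mono2 that times_div_less_eq_dividend)
  show ?thesis
    using ge by (intro exI[of _ k0] exI[of _ k1] exI[of _ "g - k0 - k1"] conjI le) (auto simp: k0_def k1_def)
qed

text \<open>If \<open>v\<close> is not special, or two factors in \<open>m\<close> are not, a
  special generator is split off from a product of two such factors. Otherwise \<open>v\<close> is
  raised lexicographically at its first difference from \<open>w\<close>, in a block
  \<open>S\<close>: either by a swap within \<open>S\<close>, or by trading \<open>c\<close> letters
  of a later block for \<open>c\<close> letters of \<open>S\<close>.\<close>

lemma pair_exchange_divisible:
  fixes l0 l1 l2 c g :: nat and \<alpha> \<beta> :: int
  defines "B0 \<equiv> {0..<l0}" and "B1 \<equiv> {l0..<l0 + l1}" and "B2 \<equiv> {l0 + l1..<l0 + l1 + l2}"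
  defines "W \<equiv> block_monoms l0 l1 l2 (g * c) (\<lambda>s t. int (g * c) dvd \<alpha> * int s + \<beta> * int t)"
    and "\<kappa> \<equiv> \<lambda>a. c dvd block_deg B0 a \<and> c dvd block_deg B1 a \<and> c dvd block_deg B2 a"
  assumes "g \<ge> 2" "c > 0" and dvd: "int (g * c) dvd \<alpha> * int c" "int (g * c) dvd \<beta> * int c"
  shows "pair_exchange W (\<lambda>a. (\<kappa> a, a))"
proof (rule pair_exchangeI)
  have fin: "finite B0" "finite B1" "finite B2" by (auto simp: B0_def B1_def B2_def)
  have disj: "B0 \<inter> B1 = {}" "B1 \<inter> B0 = {}" "B0 \<inter> B2 = {}" "B2 \<inter> B0 = {}" "B1 \<inter> B2 = {}" "B2 \<inter> B1 = {}"
    by (auto simp: B0_def B1_def B2_def)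
  have finB: "finite T" if "T \<in> {B0, B1, B2}" for T
    using that fin by auto
  have sep: "S = T \<or> S \<inter> T = {}" if "S \<in> {B0, B1, B2}" "T \<in> {B0, B1, B2}" for S T
    using that by (elim insertE emptyE) (simp_all add: disj)
  have un: "{0..<l0 + l1 + l2} = B0 \<union> B1 \<union> B2" by (auto simp: B0_def B1_def B2_def)
  have W: "a \<in> W \<longleftrightarrow> Poly_Mapping.keys a \<subseteq> B0 \<union> B1 \<union> B2 \<and> block_deg B0 a + block_deg B1 a + block_deg B2 a = g * c \<and>
      int (g * c) dvd \<alpha> * int (block_deg B1 a) + \<beta> * int (block_deg B2 a)" for a
    using block_deg_sum[of a l0 l1 l2]
    by (auto simp: W_def block_monoms_def un[symmetric] B0_def[symmetric] B1_def[symmetric] B2_def[symmetric])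
  have Wd: "int (g * c) dvd \<alpha> * int (block_deg B1 a) + \<beta> * int (block_deg B2 a)" if "a \<in> W" for a
    using that unfolding W by blast
  \<comment> \<open>Block degrees that are multiples of \<open>c\<close> satisfy the congruence by
    themselves.\<close>
  have dvd_mult: "int (g * c) dvd \<alpha> * int (c * k) + \<beta> * int (c * k')" for k k'
    using dvd_add[OF dvd_mult2[OF dvd(1), of "int k"] dvd_mult2[OF dvd(2), of "int k'"]]
    by (simp add: mult.assoc)
  show "mdeg a = g * c" if "a \<in> W" for a using that by (simp add: W_def block_monoms_def)
  show "g * c > 0" using assms(6,7) by simp
  have pair: "\<exists>x'\<in>W. \<exists>y'\<in>W. x' + y' = x + y \<and> \<kappa> x'" if xy: "x \<in> W" "y \<in> W" for x y
  proof -
    define s where "s = x + y"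
    have "block_deg B0 s + block_deg B1 s + block_deg B2 s = 2 * (g * c)"
      using xy by (simp add: W s_def block_deg_add)
    then obtain k0 k1 k2 where k: "k0 + k1 + k2 = g" "c * k0 \<le> block_deg B0 s"
        "c * k1 \<le> block_deg B1 s" "c * k2 \<le> block_deg B2 s"
      using split_multiples assms(6,7) by blast
    obtain p0 r0 where p0: "s = p0 + r0" "Poly_Mapping.keys p0 \<subseteq> B0" "block_deg B0 p0 = c * k0"
      using split_block[OF fin(1) k(2)] by blast
    have d0: "block_deg B1 p0 = 0" "block_deg B2 p0 = 0"
      using block_deg_disjoint[OF p0(2)] disj by auto
    have "c * k1 \<le> block_deg B1 r0" using k(3) d0 by (simp add: p0(1) block_deg_add)
    then obtain p1 r1 where p1: "r0 = p1 + r1" "Poly_Mapping.keys p1 \<subseteq> B1" "block_deg B1 p1 = c * k1"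
      using split_block[OF fin(2)] by blast
    have d1: "block_deg B0 p1 = 0" "block_deg B2 p1 = 0"
      using block_deg_disjoint[OF p1(2)] disj by auto
    have "c * k2 \<le> block_deg B2 r1" using k(4) d0 d1 by (simp add: p0(1) p1(1) block_deg_add)
    then obtain p2 y' where p2: "r1 = p2 + y'" "Poly_Mapping.keys p2 \<subseteq> B2" "block_deg B2 p2 = c * k2"
      using split_block[OF fin(3)] by blast
    have d2: "block_deg B0 p2 = 0" "block_deg B1 p2 = 0"
      using block_deg_disjoint[OF p2(2)] disj by auto
    define x' where "x' = p0 + p1 + p2"
    have s: "s = x' + y'" by (simp add: p0 p1 p2 x'_def ac_simps)
    have bx: "block_deg B0 x' = c * k0" "block_deg B1 x' = c * k1" "block_deg B2 x' = c * k2"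
      by (simp_all add: x'_def block_deg_add p0 p1 p2 d0 d1 d2)
    have gc: "g * c = c * k0 + c * k1 + c * k2" by (simp add: k(1)[symmetric] algebra_simps)
    have "x' \<in> W"
      unfolding W bx using p0(2) p1(2) p2(2) dvd_mult[of k1 k2]
      by (auto simp: gc x'_def keys_add_nat)
    \<comment> \<open>The cofactor inherits degree and congruence by subtraction.\<close>
    moreover have "y' \<in> W"
    proof -
      have e: "block_deg B x + block_deg B y = block_deg B x' + block_deg B y'" for B
        unfolding block_deg_add[symmetric] s[symmetric] s_def ..
      have "Poly_Mapping.keys y' \<subseteq> Poly_Mapping.keys x \<union> Poly_Mapping.keys y"
        unfolding keys_add_nat[symmetric] s_def[symmetric] s by (simp add: keys_add_nat)
      then have "Poly_Mapping.keys y' \<subseteq> B0 \<union> B1 \<union> B2"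
        using xy unfolding W by blast
      moreover have "block_deg B0 y' + block_deg B1 y' + block_deg B2 y' = g * c"
        using e[of B0] e[of B1] e[of B2] xy gc unfolding W bx by linarith
      moreover have "\<alpha> * int (block_deg B1 y') + \<beta> * int (block_deg B2 y') =
          (\<alpha> * int (block_deg B1 x) + \<beta> * int (block_deg B2 x)) +
          (\<alpha> * int (block_deg B1 y) + \<beta> * int (block_deg B2 y)) - (\<alpha> * int (c * k1) + \<beta> * int (c * k2))"
      proof -
        have "int (block_deg B1 y') = int (block_deg B1 x) + int (block_deg B1 y) - int (c * k1)"
          "int (block_deg B2 y') = int (block_deg B2 x) + int (block_deg B2 y) - int (c * k2)"
          using e[of B1] e[of B2] unfolding bx by linarith+
        then show ?thesis by (simp only: distrib_left right_diff_distrib)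
      qed
      moreover have "int (g * c) dvd \<dots>"
        by (rule dvd_diff[OF dvd_add[OF Wd[OF xy(1)] Wd[OF xy(2)]] dvd_mult])
      ultimately show ?thesis unfolding W by simp
    qed
    moreover have "\<kappa> x'" by (simp add: \<kappa>_def bx)
    ultimately show ?thesis using s unfolding s_def by (intro bexI[of _ x'] bexI[of _ y'] conjI) auto
  qed
  \<comment> \<open>Exactly one of the three coefficients is 1; this treats the three choices of a
    block uniformly.\<close>
  have block: "\<exists>k0 k1 k2. block_deg B0 p = c * k0 \<and> block_deg B1 p = c * k1 \<and> block_deg B2 p = c * k2 \<and>
      k0 + k1 + k2 = 1" if "S \<in> {B0, B1, B2}" and p: "Poly_Mapping.keys p \<subseteq> S" "block_deg S p = c" for p S
    using that(1)
  proof (elim insertE emptyE)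
    assume "S = B0"
    then show ?thesis using p block_deg_disjoint[OF p(1)] disj
      by (intro exI[of _ 1] exI[of _ 0]) auto
  next
    assume "S = B1"
    then show ?thesis using p block_deg_disjoint[OF p(1)] disj
      by (intro exI[of _ 0] exI[of _ 1] exI[of _ 0]) auto
  next
    assume "S = B2"
    then show ?thesis using p block_deg_disjoint[OF p(1)] disj
      by (intro exI[of _ 0] exI[of _ 0] exI[of _ 1]) auto
  qed
  \<comment> \<open>Trading \<open>c\<close> letters of \<open>T\<close> for \<open>c\<close>
    letters of \<open>S\<close> changes the block degrees by multiples of \<open>c\<close>, so it
    preserves total degree, congruence and specialness.\<close>
  have shift: "p + a \<in> W" "\<kappa> (q + a) \<Longrightarrow> \<kappa> (p + a)"
    if a: "q + a \<in> W" and S: "S \<in> {B0, B1, B2}" "T \<in> {B0, B1, B2}"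
      and p: "Poly_Mapping.keys p \<subseteq> S" "block_deg S p = c" and q: "Poly_Mapping.keys q \<subseteq> T" "block_deg T q = c" for a p q S T
  proof -
    obtain k0 k1 k2 where k: "block_deg B0 p = c * k0" "block_deg B1 p = c * k1" "block_deg B2 p = c * k2"
        "k0 + k1 + k2 = 1" using block[OF S(1) p] by blast
    obtain h0 h1 h2 where h: "block_deg B0 q = c * h0" "block_deg B1 q = c * h1" "block_deg B2 q = c * h2"
        "h0 + h1 + h2 = 1" using block[OF S(2) q] by blast
    have "c * k0 + c * k1 + c * k2 = c * h0 + c * h1 + c * h2"
      unfolding distrib_left[symmetric] k(4) h(4) ..
    then have "block_deg B0 (p + a) + block_deg B1 (p + a) + block_deg B2 (p + a) = g * c"
      using a unfolding W block_deg_add k h by linarith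
    moreover have "Poly_Mapping.keys (p + a) \<subseteq> B0 \<union> B1 \<union> B2"
      using a S(1) p(1) unfolding W keys_add_nat by blast
    moreover have "int (g * c) dvd \<alpha> * int (block_deg B1 (p + a)) + \<beta> * int (block_deg B2 (p + a))"
    proof -
      have "\<alpha> * int (block_deg B1 (p + a)) + \<beta> * int (block_deg B2 (p + a)) =
          (\<alpha> * int (block_deg B1 (q + a)) + \<beta> * int (block_deg B2 (q + a))) +
          (\<alpha> * int (c * k1) + \<beta> * int (c * k2)) - (\<alpha> * int (c * h1) + \<beta> * int (c * h2))"
        by (simp add: block_deg_add k h algebra_simps)
      moreover have "int (g * c) dvd \<dots>"
        by (rule dvd_diff[OF dvd_add[OF Wd[OF a] dvd_mult] dvd_mult])
      ultimately show ?thesis by simp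
    qed
    ultimately show "p + a \<in> W" unfolding W by blast
    show "\<kappa> (p + a)" if "\<kappa> (q + a)"
      using that by (simp add: \<kappa>_def block_deg_add k h dvd_add_right_iff)
  qed
  fix v w m r
  assume v: "v \<in> W" and w: "w \<in> W" and m: "m \<in> monoms W" "m \<noteq> 0"
    and eq: "v + monom_subst (\<lambda>v. v) m = w + r" and less: "(\<kappa> v, v) < (\<kappa> w, w)"
    and top: "\<And>x. x \<in> Poly_Mapping.keys m \<Longrightarrow> \<kappa> x \<Longrightarrow> \<kappa> v"
  have mW: "x \<in> W" if "x \<in> Poly_Mapping.keys m" for x using that m(1) by (auto simp: monoms_def)
  show "(\<exists>x y x' y' m0. Poly_Mapping.single v 1 + m = Poly_Mapping.single x 1 + Poly_Mapping.single y 1 + m0 \<and> x' \<in> W \<and> y' \<in> W \<and>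
         x' + y' = x + y \<and> \<not> \<kappa> x \<and> \<not> \<kappa> y \<and> \<kappa> x') \<or>
      (\<exists>x\<in>Poly_Mapping.keys m. \<exists>x'\<in>W. \<exists>y'\<in>W. x' + y' = v + x \<and> (\<kappa> v, v) < (\<kappa> x', x'))" (is "?pair \<or> ?swap")
  proof (cases "\<kappa> v")
    case False
    obtain x where x: "x \<in> Poly_Mapping.keys m" using m(2) by (metis all_not_in_conv keys_eq_empty)
    obtain x' y' where "x' \<in> W" "y' \<in> W" "x' + y' = v + x" "\<kappa> x'" using pair[OF v mW[OF x]] by blast
    then have ?swap using x False by (intro bexI[of _ x] bexI[of _ x'] bexI[of _ y']) auto
    then show ?thesis ..
  next
    case \<kappa>v: True
    then have \<kappa>w: "\<kappa> w" and vw: "v < w" using less by auto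
    show ?thesis
    proof (cases "\<exists>x y m0. m = Poly_Mapping.single x 1 + Poly_Mapping.single y 1 + m0 \<and> \<not> \<kappa> x \<and> \<not> \<kappa> y")
      case True
      then obtain x y m0 where xy: "m = Poly_Mapping.single x 1 + Poly_Mapping.single y 1 + m0" "\<not> \<kappa> x" "\<not> \<kappa> y" by blast
      then have "x \<in> W" "y \<in> W" using mW by (auto simp: keys_add_nat)
      then obtain x' y' where "x' \<in> W" "y' \<in> W" "x' + y' = x + y" "\<kappa> x'" using pair by blast
      then have ?pair using xy
        by (intro exI[of _ x] exI[of _ y] exI[of _ x'] exI[of _ y'] exI[of _ "Poly_Mapping.single v 1 + m0"]) (simp add: ac_simps)
      then show ?thesis ..
    next
      \<comment> \<open>From here on at most one factor of \<open>m\<close>, counted with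
        multiplicity, is not special.\<close>
      case one: False
      obtain i where i: "Poly_Mapping.lookup v i < Poly_Mapping.lookup w i" "\<forall>j<i. Poly_Mapping.lookup v j = Poly_Mapping.lookup w j"
        using vw unfolding monom_less_iff by blast
      have "i \<in> Poly_Mapping.keys w" using i(1) by (simp add: in_keys_iff)
      then obtain S where S: "S \<in> {B0, B1, B2}" "i \<in> S" "finite S" using w fin by (auto simp: W)
      show ?thesis
      proof (cases "block_deg S w \<le> block_deg S v")
        case True
        obtain x where x: "x \<in> Poly_Mapping.keys m" "Poly_Mapping.lookup x i > 0" using lookup_first_diff[OF eq i(1)] by blast
        obtain v' x' where vx: "v' + x' = v + x" "v < v'" "Poly_Mapping.keys v' \<subseteq> Poly_Mapping.keys v \<union> S" "Poly_Mapping.keys x' \<subseteq> Poly_Mapping.keys x \<union> S"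
          "\<forall>T. finite T \<and> (S = T \<or> S \<inter> T = {}) \<longrightarrow> block_deg T v' = block_deg T v"
          "\<forall>T. finite T \<and> (S = T \<or> S \<inter> T = {}) \<longrightarrow> block_deg T x' = block_deg T x"
          by (rule swap_in_block[OF S(3,2) i True x(2)])
        have b: "block_deg T v' = block_deg T v" "block_deg T x' = block_deg T x" if "T \<in> {B0, B1, B2}" for T
          using vx(5,6) finB[OF that] sep[OF S(1) that] by blast+
        have "S \<subseteq> B0 \<union> B1 \<union> B2" using S(1) by auto
        then have "v' \<in> W" "x' \<in> W" using v mW[OF x(1)] vx(3,4) unfolding W by (auto simp: b)
        moreover have "\<kappa> v'" using \<kappa>v by (simp add: \<kappa>_def b)
        ultimately have ?swap using vx(1,2) x(1) \<kappa>v
          by (intro bexI[of _ x] bexI[of _ v'] bexI[of _ x']) auto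
        then show ?thesis ..
      next
        case False
        have dvdS: "c dvd block_deg T a" if "\<kappa> a" "T \<in> {B0, B1, B2}" for a T
          using that by (auto simp: \<kappa>_def)
        \<comment> \<open>Distinct multiples of \<open>c\<close> differ by at least
          \<open>c\<close>; the other factors have to fill this gap between \<open>v\<close> and
          \<open>w\<close> in \<open>S\<close>.\<close>
        obtain kv kw where kvw: "block_deg S v = c * kv" "block_deg S w = c * kw"
          using dvdS[OF \<kappa>v S(1)] dvdS[OF \<kappa>w S(1)] by (auto simp: dvd_def)
        then have "kv < kw" using False assms(7) by simp
        then have "c * Suc kv \<le> c * kw" by (intro mult_le_mono2) simp
        then have "block_deg S v + c \<le> block_deg S w" by (simp add: kvw)
        also have "\<dots> \<le> block_deg S (v + monom_subst (\<lambda>v. v) m)" by (simp add: eq block_deg_add)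
        finally have cm: "c \<le> block_deg S (monom_subst (\<lambda>v. v) m)" by (simp add: block_deg_add)
        have small: "block_deg S a = 0" if "\<kappa> a" "block_deg S a < c" for a
          using dvdS[OF that(1) S(1)] that(2) by (meson nat_dvd_not_less not_gr_zero)
        \<comment> \<open>If every factor had degree below \<open>c\<close> in \<open>S\<close>, the
          special ones would have degree 0 there, and the one possible exception could not reach
          \<open>c\<close> alone.\<close>
        have "\<exists>x\<in>Poly_Mapping.keys m. c \<le> block_deg S x"
        proof (rule ccontr)
          assume "\<not> ?thesis"
          then have lt: "block_deg S x < c" if "x \<in> Poly_Mapping.keys m" for x using that by force
          show False
          proof (cases "\<exists>x\<in>Poly_Mapping.keys m. \<not> \<kappa> x")
            case True
            then obtain x where x: "x \<in> Poly_Mapping.keys m" "\<not> \<kappa> x" by blast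
            obtain m0 where m0: "m = Poly_Mapping.single x 1 + m0" by (rule in_keys_decomp[OF x(1)])
            have "block_deg S y = 0" if y: "y \<in> Poly_Mapping.keys m0" for y
            proof (rule small)
              show "\<kappa> y"
              proof (rule ccontr)
                assume "\<not> \<kappa> y"
                moreover obtain m2 where "m0 = Poly_Mapping.single y 1 + m2" by (rule in_keys_decomp[OF y])
                ultimately show False using one x(2) m0 by (metis add.assoc)
              qed
              show "block_deg S y < c" using lt y by (simp add: m0 keys_add_nat)
            qed
            then have "block_deg S (monom_subst (\<lambda>v. v) m) = block_deg S x"
              by (simp add: m0 monom_subst_add block_deg_add block_deg_monom_subst)
            then show False using cm lt[OF x(1)] by simp
          next
            case False
            then have "block_deg S (monom_subst (\<lambda>v. v) m) = 0"
              using small lt by (simp add: block_deg_monom_subst)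
            then show False using cm assms(7) by simp
          qed
        qed
        then obtain x where x: "x \<in> Poly_Mapping.keys m" "c \<le> block_deg S x" by blast
        have prefix: "block_deg T v = block_deg T w" if "\<And>j. j \<in> T \<Longrightarrow> j < i" for T
          unfolding block_deg_def using that i(2) by (intro sum.cong) auto
        have tot: "block_deg B0 v + block_deg B1 v + block_deg B2 v = block_deg B0 w + block_deg B1 w + block_deg B2 w"
          using v w unfolding W by linarith
        have large: "c \<le> block_deg T v" if "T \<in> {B0, B1, B2}" "block_deg T v > 0" for T
          using dvdS[OF \<kappa>v that(1)] that(2) by (rule dvd_imp_le)
        \<comment> \<open>All letters of the blocks before \<open>S\<close> precede
          \<open>i\<close>, so \<open>v\<close> and \<open>w\<close> have equal degrees there. As
          their total degrees agree and \<open>w\<close> has more in \<open>S\<close>,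
          \<open>v\<close> has more in a later block, hence at least \<open>c\<close>. For the last
          block this is contradictory.\<close>
        have "\<exists>T\<in>{B0, B1, B2}. c \<le> block_deg T v \<and> (\<forall>i\<in>S. \<forall>j\<in>T. i < j)"
          using S(1)
        proof (elim insertE emptyE)
          assume S0: "S = B0"
          have "block_deg B1 v > 0 \<or> block_deg B2 v > 0" using tot False unfolding S0 by linarith
          moreover have "\<forall>i\<in>S. \<forall>j\<in>B1 \<union> B2. i < j" by (auto simp: S0 B0_def B1_def B2_def)
          ultimately show ?thesis using large[of B1] large[of B2] by blast
        next
          assume S1: "S = B1"
          have "block_deg B0 v = block_deg B0 w" using S(2) S1 by (intro prefix) (auto simp: B0_def B1_def)
          then have "block_deg B2 v > 0" using tot False unfolding S1 by linarith
          moreover have "\<forall>i\<in>S. \<forall>j\<in>B2. i < j" by (auto simp: S1 B1_def B2_def)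
          ultimately show ?thesis using large[of B2] by blast
        next
          assume S2: "S = B2"
          have "block_deg B0 v = block_deg B0 w" using S(2) S2 by (intro prefix) (auto simp: B0_def B2_def)
          moreover have "block_deg B1 v = block_deg B1 w" using S(2) S2 by (intro prefix) (auto simp: B1_def B2_def)
          ultimately show ?thesis using tot False unfolding S2 by linarith
        qed
        then obtain T where T: "T \<in> {B0, B1, B2}" "c \<le> block_deg T v \<and> (\<forall>i\<in>S. \<forall>j\<in>T. i < j)"
          by (rule bexE)
        have "finite T" using T(1) fin by auto
        obtain p x0 where p: "x = p + x0" "Poly_Mapping.keys p \<subseteq> S" "block_deg S p = c"
          using split_block[OF S(3) x(2)] by blast
        obtain q v0 where q: "v = q + v0" "Poly_Mapping.keys q \<subseteq> T" "block_deg T q = c"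
          using split_block[OF \<open>finite T\<close> conjunct1[OF T(2)]] by blast
        \<comment> \<open>The \<open>c\<close> letters \<open>q\<close> of \<open>v\<close> are
          exchanged for the \<open>c\<close> earlier letters \<open>p\<close> of
          \<open>x\<close>.\<close>
        have "p + v0 \<in> W" "\<kappa> (p + v0)"
          using shift[OF v[unfolded q(1)] S(1) T(1) p(2,3) q(2,3)] \<kappa>v by (auto simp: q(1))
        moreover have "q + x0 \<in> W"
          using shift(1)[OF mW[OF x(1), unfolded p(1)] T(1) S(1) q(2,3) p(2,3)] .
        moreover have "Poly_Mapping.keys p \<noteq> {}"
        proof
          assume "Poly_Mapping.keys p = {}"
          then have "block_deg S p = 0" by (simp add: block_deg_def)
          then show False using p(3) assms(7) by simp
        qed
        then have "v < p + v0"
          unfolding q(1) using conjunct2[OF T(2)] p(2) q(2) by (intro exchange_less) auto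
        ultimately have ?swap using x(1) \<kappa>v p(1) q(1)
          by (intro bexI[of _ x] bexI[of _ "p + v0"] bexI[of _ "q + x0"]) (auto simp: ac_simps)
        then show ?thesis ..
      qed
    qed
  qed
qed

text \<open>A generator that is not special is a monomial in one of the last two blocks alone. If
  \<open>v\<close> is not special, neither is any other factor: two factors of different kinds
  combine to special ones, while factors of a single kind force \<open>w\<close> to be of that kind,
  and a swap within the block applies. If \<open>v\<close> is special, either such a swap applies,
  or two letters of \<open>B0\<close> are traded for one letter of each other block.\<close>

lemma pair_exchange_antidiagonal:
  fixes l0 l1 l2 c :: nat
  defines "B0 \<equiv> {0..<l0}" and "B1 \<equiv> {l0..<l0 + l1}" and "B2 \<equiv> {l0 + l1..<l0 + l1 + l2}"
  defines "W \<equiv> block_monoms l0 l1 l2 (2 * c) (\<lambda>s t. s = t \<or> s = 2 * c \<or> t = 2 * c)"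
    and "\<kappa> \<equiv> \<lambda>a. block_deg B1 a = block_deg B2 a"
  assumes "c > 0"
  shows "pair_exchange W (\<lambda>a. (\<kappa> a, a))"
proof (rule pair_exchangeI)
  have fin: "finite B0" "finite B1" "finite B2" by (auto simp: B0_def B1_def B2_def)
  have disj: "B0 \<inter> B1 = {}" "B1 \<inter> B0 = {}" "B0 \<inter> B2 = {}" "B2 \<inter> B0 = {}" "B1 \<inter> B2 = {}" "B2 \<inter> B1 = {}"
    by (auto simp: B0_def B1_def B2_def)
  have finB: "finite T" if "T \<in> {B0, B1, B2}" for T
    using that fin by auto
  have sep: "S = T \<or> S \<inter> T = {}" if "S \<in> {B0, B1, B2}" "T \<in> {B0, B1, B2}" for S T
    using that by (elim insertE emptyE) (simp_all add: disj)
  have un: "{0..<l0 + l1 + l2} = B0 \<union> B1 \<union> B2" by (auto simp: B0_def B1_def B2_def)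
  have W: "a \<in> W \<longleftrightarrow> Poly_Mapping.keys a \<subseteq> B0 \<union> B1 \<union> B2 \<and> block_deg B0 a + block_deg B1 a + block_deg B2 a = 2 * c \<and>
      (block_deg B1 a = block_deg B2 a \<or> block_deg B1 a = 2 * c \<or> block_deg B2 a = 2 * c)" for a
    using block_deg_sum[of a l0 l1 l2]
    by (auto simp: W_def block_monoms_def un[symmetric] B0_def[symmetric] B1_def[symmetric] B2_def[symmetric])
  have WI: "a \<in> W" if "Poly_Mapping.keys a \<subseteq> B0 \<union> B1 \<union> B2" "block_deg B0 a + block_deg B1 a + block_deg B2 a = 2 * c"
      "block_deg B1 a = block_deg B2 a" for a
    using that unfolding W by blast
  have keysW: "Poly_Mapping.keys a \<subseteq> B0 \<union> B1 \<union> B2" if "a \<in> W" for a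
    using that unfolding W by blast
  have total: "block_deg B0 a + block_deg B1 a + block_deg B2 a = 2 * c" if "a \<in> W" for a
    using that unfolding W by blast
  have zero: "block_deg B0 p = 0" if "Poly_Mapping.keys p \<subseteq> B1 \<or> Poly_Mapping.keys p \<subseteq> B2" for p
    using that block_deg_disjoint[of p _ B0] disj by blast
  have zero1: "block_deg B1 p = 0" if "Poly_Mapping.keys p \<subseteq> B0 \<or> Poly_Mapping.keys p \<subseteq> B2" for p
    using that block_deg_disjoint[of p _ B1] disj by blast
  have zero2: "block_deg B2 p = 0" if "Poly_Mapping.keys p \<subseteq> B0 \<or> Poly_Mapping.keys p \<subseteq> B1" for p
    using that block_deg_disjoint[of p _ B2] disj by blast
  show "mdeg a = 2 * c" if "a \<in> W" for a using that by (simp add: W_def block_monoms_def)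
  show "2 * c > 0" using assms(6) by simp
  \<comment> \<open>Halving is possible since the degree is even: each new generator takes
    \<open>c\<close> letters of \<open>B1\<close> from \<open>x\<close> and \<open>c\<close> letters
    of \<open>B2\<close> from \<open>y\<close>, so both are special.\<close>
  have pair: "\<exists>x'\<in>W. \<exists>y'\<in>W. x' + y' = x + y \<and> \<kappa> x'"
    if xy: "x \<in> W" "y \<in> W" "block_deg B1 x = 2 * c" "block_deg B2 y = 2 * c" for x y
  proof -
    obtain p x0 where p: "x = p + x0" "Poly_Mapping.keys p \<subseteq> B1" "block_deg B1 p = c"
      using split_block[OF fin(2), of c x] xy(3) by auto
    obtain q y0 where q: "y = q + y0" "Poly_Mapping.keys q \<subseteq> B2" "block_deg B2 q = c"
      using split_block[OF fin(3), of c y] xy(4) by auto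
    have z: "block_deg B0 p = 0" "block_deg B2 p = 0" "block_deg B0 q = 0" "block_deg B1 q = 0"
      using p(2) q(2) by (simp_all add: zero zero1 zero2)
    have k: "Poly_Mapping.keys (p + q) \<subseteq> B0 \<union> B1 \<union> B2" "Poly_Mapping.keys (x0 + y0) \<subseteq> B0 \<union> B1 \<union> B2"
      using keysW[OF xy(1)] keysW[OF xy(2)] unfolding p(1) q(1) keys_add_nat by blast+
    have t: "block_deg B0 x0 + block_deg B1 x0 + block_deg B2 x0 = c" "block_deg B1 x0 = c"
       "block_deg B0 y0 + block_deg B1 y0 + block_deg B2 y0 = c" "block_deg B2 y0 = c"
      using total[OF xy(1)] total[OF xy(2)] xy(3,4) unfolding p(1) q(1) block_deg_add p(3) q(3) z by linarith+
    have "p + q \<in> W"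
      using k(1) by (rule WI) (simp_all add: block_deg_add z p(3) q(3))
    moreover have "x0 + y0 \<in> W"
      using k(2) by (rule WI) (use t in \<open>simp_all add: block_deg_add\<close>)
    moreover have "\<kappa> (p + q)" by (simp add: \<kappa>_def block_deg_add z p(3) q(3))
    moreover have "(p + q) + (x0 + y0) = x + y" by (simp add: p(1) q(1) ac_simps)
    ultimately show ?thesis by blast
  qed
  fix v w m r
  assume v: "v \<in> W" and w: "w \<in> W" and m: "m \<in> monoms W" "m \<noteq> 0"
    and eq: "v + monom_subst (\<lambda>v. v) m = w + r" and less: "(\<kappa> v, v) < (\<kappa> w, w)"
    and top: "\<And>x. x \<in> Poly_Mapping.keys m \<Longrightarrow> \<kappa> x \<Longrightarrow> \<kappa> v"
  have mW: "x \<in> W" if "x \<in> Poly_Mapping.keys m" for x using that m(1) by (auto simp: monoms_def)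
  show "(\<exists>x y x' y' m0. Poly_Mapping.single v 1 + m = Poly_Mapping.single x 1 + Poly_Mapping.single y 1 + m0 \<and> x' \<in> W \<and> y' \<in> W \<and>
         x' + y' = x + y \<and> \<not> \<kappa> x \<and> \<not> \<kappa> y \<and> \<kappa> x') \<or>
      (\<exists>x\<in>Poly_Mapping.keys m. \<exists>x'\<in>W. \<exists>y'\<in>W. x' + y' = v + x \<and> (\<kappa> v, v) < (\<kappa> x', x'))" (is "?pair \<or> ?swap")
  proof -
    \<comment> \<open>A swap within one block preserves all block degrees, on which both membership
      in \<open>W\<close> and specialness depend.\<close>
    have swap: ?swap if i: "Poly_Mapping.lookup v i < Poly_Mapping.lookup w i" "\<forall>j<i. Poly_Mapping.lookup v j = Poly_Mapping.lookup w j"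
      and S: "S \<in> {B0, B1, B2}" "i \<in> S" "block_deg S w \<le> block_deg S v" for i S
    proof -
      have "finite S" using S(1) fin by auto
      obtain x where x: "x \<in> Poly_Mapping.keys m" "Poly_Mapping.lookup x i > 0" using lookup_first_diff[OF eq i(1)] by blast
      obtain v' x' where vx: "v' + x' = v + x" "v < v'" "Poly_Mapping.keys v' \<subseteq> Poly_Mapping.keys v \<union> S" "Poly_Mapping.keys x' \<subseteq> Poly_Mapping.keys x \<union> S"
        "\<forall>T. finite T \<and> (S = T \<or> S \<inter> T = {}) \<longrightarrow> block_deg T v' = block_deg T v"
          "\<forall>T. finite T \<and> (S = T \<or> S \<inter> T = {}) \<longrightarrow> block_deg T x' = block_deg T x"
        by (rule swap_in_block[OF \<open>finite S\<close> S(2) i S(3) x(2)])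
      have b: "block_deg T v' = block_deg T v" "block_deg T x' = block_deg T x" if "T \<in> {B0, B1, B2}" for T
        using vx(5,6) finB[OF that] sep[OF S(1) that] by blast+
      have "S \<subseteq> B0 \<union> B1 \<union> B2" using S(1) by auto
      then have "v' \<in> W" "x' \<in> W" using v mW[OF x(1)] vx(3,4) unfolding W by (auto simp: b)
      then show ?thesis using vx(1,2) x(1)
        by (intro bexI[of _ x] bexI[of _ v'] bexI[of _ x']) (auto simp: \<kappa>_def b)
    qed
    show ?thesis
    proof (cases "\<kappa> v")
      case False
      have kinds: "block_deg B1 x = 2 * c \<and> block_deg B2 x = 0 \<and> block_deg B0 x = 0 \<or>
          block_deg B2 x = 2 * c \<and> block_deg B1 x = 0 \<and> block_deg B0 x = 0" if "x \<in> W" "\<not> \<kappa> x" for x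
        using that(1) that(2) total[OF that(1)] unfolding W \<kappa>_def by auto
      show ?thesis
      proof (cases "\<exists>x\<in>Poly_Mapping.keys m. (block_deg B1 x = 2 * c) \<noteq> (block_deg B1 v = 2 * c)")
        case True
        then obtain x where x: "x \<in> Poly_Mapping.keys m" "(block_deg B1 x = 2 * c) \<noteq> (block_deg B1 v = 2 * c)" by blast
        \<comment> \<open>By \<open>top\<close>, a special factor would make \<open>v\<close>
          special.\<close>
        have kx: "\<not> \<kappa> x" using top x(1) False by blast
        have "\<exists>x'\<in>W. \<exists>y'\<in>W. x' + y' = v + x \<and> \<kappa> x'"
          using kinds[OF v False] kinds[OF mW[OF x(1)] kx] x(2)
            pair[OF v mW[OF x(1)]] pair[OF mW[OF x(1)] v] by (metis add.commute)
        then have ?swap using x(1) False by force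
        then show ?thesis ..
      next
        case same: False
        \<comment> \<open>The single block in which all factors now live.\<close>
        define S where "S = (if block_deg B1 v = 2 * c then B1 else B2)"
        have S: "S \<in> {B0, B1, B2}" by (simp add: S_def)
        have other: "block_deg T x = 0" if x: "x = v \<or> x \<in> Poly_Mapping.keys m" and T: "T \<in> {B0, B1, B2}" "T \<noteq> S" for x T
        proof -
          have "x \<in> W" "\<not> \<kappa> x" using x v mW False top by blast+
          moreover have "block_deg B1 x = 2 * c \<longleftrightarrow> block_deg B1 v = 2 * c" using same x by blast
          ultimately show ?thesis
            using kinds[of x] T assms(6) by (cases "block_deg B1 v = 2 * c") (auto simp: S_def)
        qed
        have Sv: "block_deg S v = 2 * c" using kinds[OF v False] by (auto simp: S_def)
        have ow: "block_deg T w = 0" if "T \<in> {B0, B1, B2}" "T \<noteq> S" for T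
        proof -
          have "block_deg T w + block_deg T r = block_deg T (v + monom_subst (\<lambda>v. v) m)"
            by (simp add: eq block_deg_add)
          also have "\<dots> = 0" using other that by (simp add: block_deg_add block_deg_monom_subst)
          finally show ?thesis by simp
        qed
        \<comment> \<open>Blocks may be empty here, and disjoint blocks are distinct sets only if
          one of them is nonempty.\<close>
        have "S \<noteq> {}" using Sv assms(6) by (auto simp: block_deg_def)
        \<comment> \<open>All letters of \<open>w\<close> lie in \<open>S\<close>, so equal degrees
          in \<open>B1\<close> and \<open>B2\<close> would both be 0, leaving total degree
          0.\<close>
        have "\<not> \<kappa> w"
        proof
          assume "\<kappa> w"
          show False
          proof (cases "S = B1")
            case True
            then have "B0 \<noteq> S" "B2 \<noteq> S" using \<open>S \<noteq> {}\<close> disj by auto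
            then show False using ow[of B0] ow[of B2] \<open>\<kappa> w\<close> total[OF w] assms(6) by (simp add: \<kappa>_def)
          next
            case False
            then have "S = B2" by (simp add: S_def split: if_splits)
            then have "B0 \<noteq> S" "B1 \<noteq> S" using \<open>S \<noteq> {}\<close> disj by auto
            then show False using ow[of B0] ow[of B1] \<open>\<kappa> w\<close> total[OF w] assms(6) by (simp add: \<kappa>_def)
          qed
        qed
        then have vw: "v < w" using less False by auto
        then obtain i where i: "Poly_Mapping.lookup v i < Poly_Mapping.lookup w i" "\<forall>j<i. Poly_Mapping.lookup v j = Poly_Mapping.lookup w j"
          unfolding monom_less_iff by blast
        have "i \<in> Poly_Mapping.keys w" using i(1) by (simp add: in_keys_iff)
        then obtain T where T: "T \<in> {B0, B1, B2}" "i \<in> T" "finite T" using keysW[OF w] fin by auto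
        have "T = S"
        proof (rule ccontr)
          assume "T \<noteq> S"
          then show False
            using ow[OF T(1)] lookup_le_block_deg[OF T(3,2), of w] i(1) by simp
        qed
        moreover have "block_deg S w \<le> block_deg S v" using total[OF w] S Sv by auto
        ultimately show ?thesis using swap[OF i S] T(2) by blast
      qed
    next
      case \<kappa>v: True
      then have \<kappa>w: "\<kappa> w" and vw: "v < w" using less by auto
      obtain i where i: "Poly_Mapping.lookup v i < Poly_Mapping.lookup w i" "\<forall>j<i. Poly_Mapping.lookup v j = Poly_Mapping.lookup w j"
        using vw unfolding monom_less_iff by blast
      have "i \<in> Poly_Mapping.keys w" using i(1) by (simp add: in_keys_iff)
      then obtain S where S: "S \<in> {B0, B1, B2}" "i \<in> S" "finite S" using keysW[OF w] fin by auto
      show ?thesis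
      proof (cases "block_deg S w \<le> block_deg S v")
        case True
        then show ?thesis using swap[OF i S(1,2)] by blast
      next
        case False
        \<comment> \<open>Otherwise all of \<open>B0\<close> precedes \<open>i\<close>, so the
          degrees in \<open>B0\<close> agree; for special \<open>v\<close> and \<open>w\<close> of
          equal total degree, the other block degrees then agree too.\<close>
        have S0: "S = B0"
        proof (rule ccontr)
          assume "S \<noteq> B0"
          then have "S = B1 \<or> S = B2" using S(1) by auto
          then have "block_deg B0 v = block_deg B0 w"
            unfolding block_deg_def using S(2) i(2) by (intro sum.cong) (auto simp: B0_def B1_def B2_def)
          then have "block_deg B1 v = block_deg B1 w" "block_deg B2 v = block_deg B2 w"
            using total[OF v] total[OF w] \<kappa>v \<kappa>w unfolding \<kappa>_def by linarith+
          then show False using False \<open>S = B1 \<or> S = B2\<close> by auto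
        qed
        obtain x where x: "x \<in> Poly_Mapping.keys m" "Poly_Mapping.lookup x i > 0" using lookup_first_diff[OF eq i(1)] by blast
        have "block_deg B0 x > 0"
          using lookup_le_block_deg[OF S(3,2), of x] x(2) S0 by simp
        \<comment> \<open>A letter in \<open>B0\<close> rules out degree \<open>2 * c\<close> in
          another block, so \<open>x\<close> is special; its degree in \<open>B0\<close> is then
          even, hence at least 2.\<close>
        then have bx: "block_deg B1 x = block_deg B2 x"
          using mW[OF x(1)] total[OF mW[OF x(1)]] unfolding W by linarith
        then have "2 \<le> block_deg B0 x"
          using total[OF mW[OF x(1)]] \<open>block_deg B0 x > 0\<close> by presburger
        then obtain p x0 where p: "x = p + x0" "Poly_Mapping.keys p \<subseteq> B0" "block_deg B0 p = 2"
          using split_block[OF fin(1)] by blast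
        \<comment> \<open>Having less in \<open>B0\<close> than \<open>w\<close>, \<open>v\<close>
          has letters in the other blocks, equally many in each. One of each is given up for two
          letters of \<open>B0\<close>, which keeps the degrees in \<open>B1\<close> and
          \<open>B2\<close> equal for both factors.\<close>
        have "1 \<le> block_deg B1 v" "1 \<le> block_deg B2 v"
          using False total[OF v] total[OF w] \<kappa>v unfolding S0 \<kappa>_def by linarith+
        then obtain q1 v1 where q1: "v = q1 + v1" "Poly_Mapping.keys q1 \<subseteq> B1" "block_deg B1 q1 = 1"
          using split_block[OF fin(2)] by blast
        have "1 \<le> block_deg B2 v1"
          using \<open>1 \<le> block_deg B2 v\<close> q1(2) zero2[of q1] by (simp add: q1(1) block_deg_add)
        then obtain q2 v2 where q2: "v1 = q2 + v2" "Poly_Mapping.keys q2 \<subseteq> B2" "block_deg B2 q2 = 1"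
          using split_block[OF fin(3)] by blast
        have z: "block_deg B1 p = 0" "block_deg B2 p = 0" "block_deg B0 q1 = 0" "block_deg B2 q1 = 0"
           "block_deg B0 q2 = 0" "block_deg B1 q2 = 0"
          using p(2) q1(2) q2(2) by (simp_all add: zero zero1 zero2)
        have v2: "v = (q1 + q2) + v2" by (simp add: q1(1) q2(1) ac_simps)
        have k: "Poly_Mapping.keys (p + v2) \<subseteq> B0 \<union> B1 \<union> B2" "Poly_Mapping.keys ((q1 + q2) + x0) \<subseteq> B0 \<union> B1 \<union> B2"
          using keysW[OF v, unfolded v2] keysW[OF mW[OF x(1)], unfolded p(1)] unfolding keys_add_nat by blast+
        have "p + v2 \<in> W"
          using total[OF v] \<kappa>v by (intro WI[OF k(1)]) (simp_all add: v2 \<kappa>_def block_deg_add z p(3) q1(3) q2(3))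
        moreover have "\<kappa> (p + v2)"
          using \<kappa>v by (simp add: v2 \<kappa>_def block_deg_add z q1(3) q2(3))
        moreover have "(q1 + q2) + x0 \<in> W"
          using total[OF mW[OF x(1)]] bx
          by (intro WI[OF k(2)]) (simp_all add: p(1) block_deg_add z p(3) q1(3) q2(3))
        moreover have "Poly_Mapping.keys p \<noteq> {}"
        proof
          assume "Poly_Mapping.keys p = {}"
          then have "block_deg B0 p = 0" by (simp add: block_deg_def)
          then show False using p(3) by simp
        qed
        then have "v < p + v2"
          unfolding v2 using p(2) q1(2) q2(2)
          by (intro exchange_less) (auto simp: keys_add_nat B0_def B1_def B2_def dest!: subsetD)
        ultimately have ?swap using x(1) \<kappa>v p(1) v2
          by (intro bexI[of _ x] bexI[of _ "p + v2"] bexI[of _ "(q1 + q2) + x0"]) (auto simp: ac_simps)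
        then show ?thesis ..
      qed
    qed
  qed
qed

section \<open>The coordinate rings\<close>

lemma coordinate_ring_G_quadraticI:
  fixes rk :: "nat monom \<Rightarrow> 'b::linorder" and G :: "'a::field mat set"
  assumes "d > 0" "inj rk" "pair_exchange (invariant_monoms n d G) rk"
  shows "coordinate_ring_G_quadratic n d G"
proof -
  have "invariant_monoms n d G \<subseteq> {m \<in> monoms {0..n}. mdeg m = d}"
    by (auto simp: invariant_monoms_def)
  then have "finite (invariant_monoms n d G)"
    by (rule finite_subset) (simp add: finite_monoms_mdeg)
  moreover have "inj_on rk (invariant_monoms n d G)"
    using assms(2) by (rule inj_on_subset) simp
  ultimately have "G_quadratic (invariant_monoms n d G)
      {p \<in> carrier (mpoly_ring (invariant_monoms n d G)). mpoly_subst of_monom p = (0 :: (nat, 'a) mpoly)}"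
    using assms by (intro G_quadratic_toric[where d = d]) (auto simp: invariant_monoms_def)
  moreover have "toric_ideal n d G =
      {p \<in> carrier (mpoly_ring (invariant_monoms n d G)). mpoly_subst of_monom p = (0 :: (nat, 'a) mpoly)}"
    by (simp add: toric_ideal_def a_kernel_def kernel_def mpoly_ring_def)
  ultimately show ?thesis by (simp add: coordinate_ring_G_quadratic_def)
qed

section \<open>Invariance as a congruence on block degrees\<close>

lemma invariant_monoms_diag_M:
  fixes e :: "'a::field"
  assumes "d > 0" "primitive_root_of_unity d e" "n + 1 = l0 + l1 + l2"
  shows "invariant_monoms n d (generate (GL (n + 1)) {diag_M e l0 l1 l2 \<alpha> \<beta>}) =
    block_monoms l0 l1 l2 d (\<lambda>s t. int d dvd \<alpha> * int s + \<beta> * int t)"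
proof -
  have "e \<noteq> 0"
    using assms(1,2) by (auto simp: primitive_root_of_unity_def power_0_left)
  have "diag_M e l0 l1 l2 \<alpha> \<beta> \<in> carrier (GL (n + 1))"
    unfolding assms(3) using \<open>e \<noteq> 0\<close> by (rule diag_M_in_GL)
  moreover have "diagonal_mat (diag_M e l0 l1 l2 \<alpha> \<beta>)"
    by (simp add: diagonal_mat_def diag_M_def mat_diag_def)
  ultimately have "invariant_monoms n d (generate (GL (n + 1)) {diag_M e l0 l1 l2 \<alpha> \<beta>}) =
      {m \<in> monoms {0..n}. mdeg m = d \<and> (\<Prod>i\<in>Poly_Mapping.keys m. (diag_M e l0 l1 l2 \<alpha> \<beta> $$ (i, i)) ^ Poly_Mapping.lookup m i) = 1}"
    by (rule invariant_monoms_generate)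
  moreover have "{0..n} = {0..<l0 + l1 + l2}" using assms(3) by auto
  ultimately show ?thesis
    unfolding block_monoms_def monoms_def
    using prod_diag_M[OF \<open>e \<noteq> 0\<close>, of _ l0 l1 l2 \<alpha> \<beta>] primitive_root_powi_eq_1_iff[OF assms(2,1)]
    by (auto simp: lessThan_atLeast0)
qed

text \<open>Modulo \<open>d\<close> the expression is \<open>k * (s - t)\<close> with
  \<open>k\<close> a unit. As \<open>s + t \<le> d\<close>, the difference of \<open>s\<close> and
  \<open>t\<close> is a multiple of \<open>d\<close> only if it is 0 or one of them is
  \<open>d\<close> and the other 0.\<close>

lemma dvd_antidiagonal_iff:
  fixes d s t :: nat and k :: int
  assumes "gcd (int d) k = 1" "s + t \<le> d"
  shows "int d dvd k * int s + (int d - k) * int t \<longleftrightarrow> s = t \<or> s = d \<or> t = d"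
proof -
  have "k * int s + (int d - k) * int t = k * (int s - int t) + int d * int t"
    by (simp add: algebra_simps)
  then have "int d dvd k * int s + (int d - k) * int t \<longleftrightarrow> int d dvd k * (int s - int t)"
    by (metis dvd_add_left_iff dvd_triv_left)
  also have "\<dots> \<longleftrightarrow> int d dvd int s - int t"
    using assms(1) by (simp add: coprime_dvd_mult_right_iff coprime_iff_gcd_eq_1)
  also have "\<dots> \<longleftrightarrow> s = t \<or> s = d \<or> t = d"
  proof
    assume dvd: "int d dvd int s - int t"
    show "s = t \<or> s = d \<or> t = d"
    proof (cases "s = t")
      case False
      then have "int d \<le> \<bar>int s - int t\<bar>" using dvd by (intro zdvd_imp_le) auto
      then show ?thesis using assms(2) by linarith
    qed simp
  next
    assume "s = t \<or> s = d \<or> t = d"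
    moreover have "t = 0" if "s = d" using that assms(2) by simp
    moreover have "s = 0" if "t = d" using that assms(2) by simp
    ultimately show "int d dvd int s - int t" by auto
  qed
  finally show ?thesis .
qed

theorem corollary4p16:
  fixes e :: "'a::{alg_closed_field, field_char_0}"
    and d n l0 l1 l2 :: nat
  assumes "d > 0"
    and "primitive_root_of_unity d e"
    and "l0 \<ge> 1" and "l1 \<ge> 1" and "l2 \<ge> 1"
    and "n + 1 = l0 + l1 + l2"
  shows "(\<forall>k::int. even d \<and> gcd (int d) k = 1 \<longrightarrow>
            coordinate_ring_G_quadratic n d
              (generate (GL (n + 1)) {diag_M e l0 l1 l2 k (int d - k)}))
       \<and> (\<forall>\<alpha>1 \<alpha>2 :: int. gcd (int d) (gcd \<alpha>1 \<alpha>2) > 1 \<longrightarrow>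
            coordinate_ring_G_quadratic n d
              (generate (GL (n + 1)) {diag_M e l0 l1 l2 \<alpha>1 \<alpha>2}))"
proof (intro conjI allI impI)
  note inv = invariant_monoms_diag_M[OF assms(1,2,6)]
  fix k :: int
  assume k: "even d \<and> gcd (int d) k = 1"
  then obtain c where c: "d = 2 * c" by blast
  have "block_monoms l0 l1 l2 d (\<lambda>s t. int d dvd k * int s + (int d - k) * int t) =
      block_monoms l0 l1 l2 d (\<lambda>s t. s = t \<or> s = d \<or> t = d)"
  proof -
    have "block_deg {l0..<l0 + l1} a + block_deg {l0 + l1..<l0 + l1 + l2} a \<le> d"
      if "Poly_Mapping.keys a \<subseteq> {0..<l0 + l1 + l2}" "mdeg a = d" for a
      using block_deg_sum[OF that(1)] that(2) by linarith
    then show ?thesis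
      unfolding block_monoms_def using k
      by (intro Collect_cong conj_cong refl dvd_antidiagonal_iff) auto
  qed
  then have "pair_exchange (invariant_monoms n d (generate (GL (n + 1)) {diag_M e l0 l1 l2 k (int d - k)}))
      (\<lambda>a. (block_deg {l0..<l0 + l1} a = block_deg {l0 + l1..<l0 + l1 + l2} a, a))"
    unfolding inv using pair_exchange_antidiagonal[of c l0 l1 l2] assms(1) unfolding c by simp
  then show "coordinate_ring_G_quadratic n d (generate (GL (n + 1)) {diag_M e l0 l1 l2 k (int d - k)})"
    \<comment> \<open>The rank is injective because its second component is the monomial
      itself.\<close>
    by (rule coordinate_ring_G_quadraticI[OF assms(1), rotated]) (simp add: inj_def)
next
  note inv = invariant_monoms_diag_M[OF assms(1,2,6)]
  fix \<alpha>1 \<alpha>2 :: int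
  assume gcd: "gcd (int d) (gcd \<alpha>1 \<alpha>2) > 1"
  define g where "g = nat (gcd (int d) (gcd \<alpha>1 \<alpha>2))"
  have g: "int g = gcd (int d) (gcd \<alpha>1 \<alpha>2)" "g \<ge> 2" using gcd by (simp_all add: g_def)
  have "int g dvd int d" unfolding g(1) by simp
  then have "g dvd d" by simp
  then obtain c where c: "d = g * c" by (rule dvdE)
  have "int g dvd \<alpha>1" "int g dvd \<alpha>2" unfolding g(1) by (auto intro: dvd_trans)
  \<comment> \<open>As \<open>g\<close> divides both exponents, \<open>c\<close> letters of a block
    contribute a multiple of \<open>d = g * c\<close> to the congruence.\<close>
  then have "int (g * c) dvd \<alpha>1 * int c" "int (g * c) dvd \<alpha>2 * int c" by simp_all
  then have "pair_exchange (invariant_monoms n d (generate (GL (n + 1)) {diag_M e l0 l1 l2 \<alpha>1 \<alpha>2}))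
      (\<lambda>a. (c dvd block_deg {0..<l0} a \<and> c dvd block_deg {l0..<l0 + l1} a \<and>
        c dvd block_deg {l0 + l1..<l0 + l1 + l2} a, a))"
    unfolding inv unfolding c
    by (intro pair_exchange_divisible) (use g(2) assms(1) c in simp_all)
  then show "coordinate_ring_G_quadratic n d (generate (GL (n + 1)) {diag_M e l0 l1 l2 \<alpha>1 \<alpha>2})"
    by (rule coordinate_ring_G_quadraticI[OF assms(1), rotated]) (simp add: inj_def)
qed

end
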